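(* Let $\alpha>0$, and let $\{f_t\}_{t\in T}\subset L_+^\alpha(S_{I,N},\lambda_{I,N})$ and $\{g_t\}_{t\in T}\subset L_+^\alpha(S,\mu)$ be two spectral representations of an $\alpha$-Fréchet process $\{X_t\}_{t\in T}$, where $(S,\mu)$ is a standard Lebesgue space. Let $U$ be the relating max-linear isometry of $\{f_t\}$ and $\{g_t\}$, i.e. the max-linear isometry from $\overline{\vee\text{-span}}\{f_t\}_{t\in T}$ to $\overline{\vee\text{-span}}\{g_t\}_{t\in T}$ with $Uf_t=g_t$ for all $t\in T$. If $\{f_t\}$ is minimal and $\{g_t\}$ is arbitrary, then: (i) $U$ can be uniquely extended (as a max-linear isometry) to $L_+^\alpha(S_{I,N},\lambda_{I,N})$; (ii) $U$ can be represented by measurable functions $\Phi:S\to S_{I,N}$ and $h:S\to\mathbb R_+\setminus\{0\}$, such that $\Phi$ is onto and the following hold: for every $t\in T$, $$g_t(s)=Uf_t(s)=h(s)\,(f_t\circ\Phi)(s)\quad\mu\text{-a.e.},$$ and $$d\lambda_{I,N}=d(\mu_h\circ\Phi^{-1}),\qquad\text{where } d\mu_h(s)=h(s)^\alpha d\mu .$$ $\Phi$ is unique modulo $\mu$.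
   Context: A standard Lebesgue space is a standard Borel space with a $\sigma$-finite measure. $L_+^\alpha(S,\mu)$ is the set of measurable $f:S\to[0,\infty)$ with $\int_Sf^\alpha d\mu<\infty$, with metric $\rho_{\mu,\alpha}(f,g)=\int_S|f^\alpha-g^\alpha|d\mu$. $\overline{\vee\text{-span}}\{f_t\}_{t\in T}$ is the $\rho_{\mu,\alpha}$-closure of the set of all $\bigvee_{1\le i\le n}a_if_{t_i}$, $a_i>0$, $t_i\in T$. A max-linear isometry $U$ between sets of functions on $(S_1,\mu_1)$ and $(S_2,\mu_2)$ satisfies $U(a_1f_1\vee a_2f_2)=a_1Uf_1\vee a_2Uf_2$ $\mu_2$-a.e. ($a_1,a_2\ge0$) and $\int (Uf)^\alpha d\mu_2=\int f^\alpha d\mu_1$ for all functions in its domain. A random variable is $\alpha$-Fréchet with scale $\sigma>0$ if its distribution function is $\exp(-\sigma^\alpha x^{-\alpha})$, $x>0$; a process is $\alpha$-Fréchet if all $\max_{1\le j\le n}a_jX_{t_j}$, $a_j>0$, are $\alpha$-Fréchet. $\{f_t\}\subset L_+^\alpha(S,\mu)$ is a spectral representation of $X$ if $P(X_{t_1}\le x_1,\dots,X_{t_n}\le x_n)=\exp\{-\int_S(\bigvee_{i}x_i^{-1}f_{t_i})^\alpha d\mu\}$ for all $n$, $t_i\in T$, $x_i>0$. $\mathrm{supp}\{f_t:t\in T\}$ is $\{f_0\ne0\}$ (mod $\mu$) for any $f_0\in\overline{\vee\text{-span}}\{f_t\}$ with $\mu(\{g\neq0\}\setminus\{f_0\ne0\})=0$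 for all $g\in\overline{\vee\text{-span}}\{f_t\}$. $\rho(\{f_t:t\in T\})$ is the $\sigma$-field generated by the ratios $f_t/f_{t'}$, $t,t'\in T$, with values in $[0,\infty]$. A representation $\{f_t\}\subset L_+^\alpha(S,\mu)$ is minimal if $\mathrm{supp}\{f_t:t\in T\}=S$ $\mu$-a.e. and for every measurable $B\subset S$ there is $A\in\rho(\{f_t:t\in T\})$ with $\mu(A\Delta B)=0$. $(S_{I,N},\lambda_{I,N})$, with $I\in\{0,1\}$ and $N\in\{0,1,2,\dots\}\cup\{\infty\}$: $S_{I,N}\subset(0,1)\cup\mathbb N$, where $S_{I,N}\cap(0,1)$ is $\emptyset$ if $I=0$ and $(0,1)$ if $I=1$, and $S_{I,N}\cap\mathbb N$ is $\emptyset$, $\{1,\dots,N\}$, or $\mathbb N$ according as $N=0$, $N\in\mathbb N$, or $N=\infty$; $\lambda_{I,N}$ is Lebesgue measure on the part in $(0,1)$ and counting measure on the part in $\mathbb N$.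
   Formalization: As g_t may all vanish on a set of positive measure, h is only required to be ≥ 0, with {h > 0} = supp{g_t} mod μ, and Φ is unique μ-a.e. on {h > 0}; if supp{g_t} = S μ-a.e., then h > 0 everywhere and Φ is unique modulo μ, as printed. *)

theory Defs
  imports "HOL-Probability.Probability"
begin

section \<open>Standard Lebesgue spaces\<close>

text \<open>A standard Borel space is a measurable space whose sigma-field is generated by the open sets
  of some Polish topology on it.\<close>

definition standard_borel_space :: "'a measure \<Rightarrow> bool" where
  "standard_borel_space M \<longleftrightarrow>
     (\<exists>X. completely_metrizable_space X \<and> separable_space X \<and>
          topspace X = space M \<and> sets M = sigma_sets (space M) {V. openin X V})"

definition standard_lebesgue_space :: "'a measure \<Rightarrow> bool" where
  "standard_lebesgue_space M \<longleftrightarrow> standard_borel_space M \<and> sigma_finite_measure M"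

section \<open>The spaces \<open>L\<^sub>+\<^sup>\<alpha>\<close> and max-linear isometries\<close>

text \<open>Elements of \<open>L\<^sub>+\<^sup>\<alpha>(S,\<mu>)\<close> are represented by actual functions on the space of the measure;
  only their values on that space are constrained, and identities between them are stated almost
  everywhere. As \<open>0 powr \<alpha> = 0\<close>, the library power agrees with \<open>x \<mapsto> x\<^sup>\<alpha>\<close> on \<open>[0,\<infinity>)\<close> for \<open>\<alpha> > 0\<close>.\<close>

definition Lplus :: "'a measure \<Rightarrow> real \<Rightarrow> ('a \<Rightarrow> real) set" where
  "Lplus M \<alpha> = {f \<in> borel_measurable M.
     (\<forall>s\<in>space M. 0 \<le> f s) \<and> integrable M (\<lambda>s. f s powr \<alpha>)}"

definition rho_dist :: "'a measure \<Rightarrow> real \<Rightarrow> ('a \<Rightarrow> real) \<Rightarrow> ('a \<Rightarrow> real) \<Rightarrow> real" where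
  "rho_dist M \<alpha> f g = (\<integral>s. \<bar>f s powr \<alpha> - g s powr \<alpha>\<bar> \<partial>M)"

definition max_span :: "('t \<Rightarrow> 'a \<Rightarrow> real) \<Rightarrow> 't set \<Rightarrow> ('a \<Rightarrow> real) set" where
  "max_span f T = {(\<lambda>s. Max ((\<lambda>i. a i * f (t i) s) ` {1..n})) | (n::nat) (a :: nat \<Rightarrow> real) t.
     1 \<le> n \<and> (\<forall>i\<in>{1..n}. 0 < a i \<and> t i \<in> T)}"

definition closed_max_span ::
  "'a measure \<Rightarrow> real \<Rightarrow> ('t \<Rightarrow> 'a \<Rightarrow> real) \<Rightarrow> 't set \<Rightarrow> ('a \<Rightarrow> real) set" where
  "closed_max_span M \<alpha> f T =
     {g \<in> Lplus M \<alpha>. \<forall>\<epsilon>>0. \<exists>k\<in>max_span f T. rho_dist M \<alpha> g k < \<epsilon>}"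

definition max_linear_isometry ::
  "'a measure \<Rightarrow> ('a \<Rightarrow> real) set \<Rightarrow> 'b measure \<Rightarrow> ('b \<Rightarrow> real) set \<Rightarrow> real \<Rightarrow>
   (('a \<Rightarrow> real) \<Rightarrow> ('b \<Rightarrow> real)) \<Rightarrow> bool" where
  "max_linear_isometry M1 D1 M2 D2 \<alpha> U \<longleftrightarrow>
     (\<forall>f\<in>D1. U f \<in> D2) \<and>
     (\<forall>f1\<in>D1. \<forall>f2\<in>D1. \<forall>a1\<ge>0. \<forall>a2\<ge>0.
        AE s in M2. U (\<lambda>x. max (a1 * f1 x) (a2 * f2 x)) s = max (a1 * U f1 s) (a2 * U f2 s)) \<and>
     (\<forall>f\<in>D1. (\<integral>s. U f s powr \<alpha> \<partial>M2) = (\<integral>s. f s powr \<alpha> \<partial>M1))"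

section \<open>Frechet processes and spectral representations\<close>

definition frechet_rv :: "'p measure \<Rightarrow> real \<Rightarrow> real \<Rightarrow> ('p \<Rightarrow> real) \<Rightarrow> bool" where
  "frechet_rv P \<alpha> \<sigma> Y \<longleftrightarrow> Y \<in> borel_measurable P \<and> 0 < \<sigma> \<and>
     (\<forall>x>0. measure P {\<omega>\<in>space P. Y \<omega> \<le> x} = exp (- (\<sigma> powr \<alpha> * x powr (- \<alpha>))))"

definition frechet_process ::
  "'p measure \<Rightarrow> real \<Rightarrow> ('t \<Rightarrow> 'p \<Rightarrow> real) \<Rightarrow> 't set \<Rightarrow> bool" where
  "frechet_process P \<alpha> X T \<longleftrightarrow>
     (\<forall>t\<in>T. X t \<in> borel_measurable P) \<and>
     (\<forall>(n::nat) a t. 1 \<le> n \<and> (\<forall>j\<in>{1..n}. 0 < a j \<and> t j \<in> T) \<longrightarrow>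
        (\<exists>\<sigma>. frechet_rv P \<alpha> \<sigma> (\<lambda>\<omega>. Max ((\<lambda>j. a j * X (t j) \<omega>) ` {1..n}))))"

definition spectral_representation ::
  "'p measure \<Rightarrow> ('t \<Rightarrow> 'p \<Rightarrow> real) \<Rightarrow> 'a measure \<Rightarrow> real \<Rightarrow> ('t \<Rightarrow> 'a \<Rightarrow> real) \<Rightarrow> 't set \<Rightarrow> bool" where
  "spectral_representation P X M \<alpha> f T \<longleftrightarrow>
     (\<forall>t\<in>T. f t \<in> Lplus M \<alpha>) \<and>
     (\<forall>(n::nat) t x. 1 \<le> n \<and> (\<forall>i\<in>{1..n}. t i \<in> T \<and> 0 < x i) \<longrightarrow>
        measure P {\<omega>\<in>space P. \<forall>i\<in>{1..n}. X (t i) \<omega> \<le> x i} =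
        exp (- (\<integral>s. (Max ((\<lambda>i. inverse (x i) * f (t i) s) ` {1..n})) powr \<alpha> \<partial>M)))"

section \<open>Support, ratio sigma-field and minimality\<close>

text \<open>The support is only defined modulo null sets; the predicate says that the measurable set \<open>A\<close>
  is a version of it.\<close>

definition is_supp ::
  "'a measure \<Rightarrow> real \<Rightarrow> ('t \<Rightarrow> 'a \<Rightarrow> real) \<Rightarrow> 't set \<Rightarrow> 'a set \<Rightarrow> bool" where
  "is_supp M \<alpha> f T A \<longleftrightarrow> A \<in> sets M \<and>
     (\<exists>f0\<in>closed_max_span M \<alpha> f T.
        (\<forall>g\<in>closed_max_span M \<alpha> f T.
           emeasure M ({s\<in>space M. g s \<noteq> 0} - {s\<in>space M. f0 s \<noteq> 0}) = 0) \<and>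
        emeasure M ((A - {s\<in>space M. f0 s \<noteq> 0}) \<union> ({s\<in>space M. f0 s \<noteq> 0} - A)) = 0)"

text \<open>Division on \<^typ>\<open>ennreal\<close> gives \<open>x / 0 = \<infinity>\<close> for \<open>x > 0\<close> and \<open>0 / 0 = 0\<close>. Under the
  full-support condition required below, the value chosen for \<open>0 / 0\<close> changes the sigma-field only by
  null sets.\<close>

definition ratio_sigma :: "'a measure \<Rightarrow> ('t \<Rightarrow> 'a \<Rightarrow> real) \<Rightarrow> 't set \<Rightarrow> 'a set set" where
  "ratio_sigma M f T = sigma_sets (space M)
     {(\<lambda>s. ennreal (f t s) / ennreal (f t' s)) -` B \<inter> space M | t t' B.
        t \<in> T \<and> t' \<in> T \<and> B \<in> sets borel}"

definition minimal_family :: "'a measure \<Rightarrow> real \<Rightarrow> ('t \<Rightarrow> 'a \<Rightarrow> real) \<Rightarrow> 't set \<Rightarrow> bool" where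
  "minimal_family M \<alpha> f T \<longleftrightarrow>
     is_supp M \<alpha> f T (space M) \<and>
     (\<forall>B\<in>sets M. \<exists>A\<in>ratio_sigma M f T. emeasure M ((A - B) \<union> (B - A)) = 0)"

section \<open>The standardized spaces\<close>

text \<open>The space is realised inside \<open>\<real>\<close>, the positive integers being disjoint from \<open>(0,1)\<close>.\<close>

definition S_IN :: "nat \<Rightarrow> enat \<Rightarrow> real set" where
  "S_IN I N = (if I = 0 then {} else {0<..<1}) \<union> real ` {n. 1 \<le> n \<and> enat n \<le> N}"

definition lambda_IN :: "nat \<Rightarrow> enat \<Rightarrow> real measure" where
  "lambda_IN I N = measure_of (S_IN I N) (sets (restrict_space borel (S_IN I N)))
     (\<lambda>A. emeasure lborel (A \<inter> {0<..<1}) + emeasure (count_space UNIV) (A \<inter> range real))"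

lemma space_lambda_IN [simp]: "space (lambda_IN I N) = S_IN I N"
  unfolding lambda_IN_def
  by (rule space_measure_of) (use sets.sets_into_space in \<open>fastforce simp: space_restrict_space\<close>)

lemma sets_lambda_IN [simp]: "sets (lambda_IN I N) = sets (restrict_space borel (S_IN I N))"
proof -
  have "space (restrict_space borel (S_IN I N)) = S_IN I N"
    by (simp add: space_restrict_space)
  then show ?thesis
    unfolding lambda_IN_def by (metis sets.sets_measure_of_eq)
qed

lemma S_IN_borel: "S_IN I N \<in> sets borel"
proof -
  have "countable (real ` {n. 1 \<le> n \<and> enat n \<le> N})" by auto
  then have "real ` {n. 1 \<le> n \<and> enat n \<le> N} \<in> sets borel"
    by (rule sets.countable[rotated]) auto
  then show ?thesis unfolding S_IN_def by auto
qed

lemma emeasure_lambda_IN: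
  assumes A: "A \<in> sets (lambda_IN I N)"
  shows "emeasure (lambda_IN I N) A =
    emeasure lborel (A \<inter> {0<..<1}) + emeasure (count_space UNIV) (A \<inter> range real)"
proof (rule emeasure_measure_of[OF lambda_IN_def])
  show "sets (restrict_space borel (S_IN I N)) \<subseteq> Pow (S_IN I N)"
    by (metis sets.space_closed sets_lambda_IN space_lambda_IN)
  show "A \<in> sets (lambda_IN I N)" by fact
  show "positive (sets (lambda_IN I N))
     (\<lambda>A. emeasure lborel (A \<inter> {0<..<1}) + emeasure (count_space UNIV) (A \<inter> range real))"
    by (simp add: positive_def)
  show "countably_additive (sets (lambda_IN I N))
     (\<lambda>A. emeasure lborel (A \<inter> {0<..<1}) + emeasure (count_space UNIV) (A \<inter> range real))"
  proof (rule countably_additiveI)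
    fix F :: "nat \<Rightarrow> real set"
    assume F: "range F \<subseteq> sets (lambda_IN I N)" and d: "disjoint_family F"
    have b: "F i \<in> sets borel" for i
    proof -
      have "F i \<in> sets (restrict_space borel (S_IN I N))" using F by auto
      then show ?thesis using S_IN_borel[of I N] by (simp add: sets_restrict_space_iff)
    qed
    have d1: "disjoint_family (\<lambda>i. F i \<inter> {0<..<1})" "disjoint_family (\<lambda>i. F i \<inter> range real)"
      using d by (auto simp: disjoint_family_on_def)
    have "(\<Sum>i. emeasure lborel (F i \<inter> {0<..<1})) = emeasure lborel (\<Union>i. F i \<inter> {0<..<1})"
      using b d1 by (intro suminf_emeasure) auto
    moreover have "(\<Sum>i. emeasure (count_space UNIV) (F i \<inter> range real)) =
      emeasure (count_space UNIV) (\<Union>i. F i \<inter> range real)"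
      using d1 by (intro suminf_emeasure) auto
    ultimately show "(\<Sum>i. emeasure lborel (F i \<inter> {0<..<1}) +
          emeasure (count_space UNIV) (F i \<inter> range real)) =
        emeasure lborel ((\<Union>i. F i) \<inter> {0<..<1}) +
          emeasure (count_space UNIV) ((\<Union>i. F i) \<inter> range real)"
      by (simp add: suminf_add[symmetric])
  qed
qed

section \<open>Point representation of the relating isometry\<close>

text \<open>Only \<open>h \<ge> 0\<close> is required here: every \<open>g\<^sub>t\<close> may vanish on a set of positive measure, and \<open>h\<close> is
  then forced to be zero almost everywhere on it.\<close>

definition represented_by ::
  "real measure \<Rightarrow> 'b measure \<Rightarrow> real \<Rightarrow> ('t \<Rightarrow> real \<Rightarrow> real) \<Rightarrow> ('t \<Rightarrow> 'b \<Rightarrow> real) \<Rightarrow> 't set \<Rightarrow>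
   ((real \<Rightarrow> real) \<Rightarrow> ('b \<Rightarrow> real)) \<Rightarrow> ('b \<Rightarrow> real) \<Rightarrow> ('b \<Rightarrow> real) \<Rightarrow> bool" where
  "represented_by L M \<alpha> f g T U \<Phi> h \<longleftrightarrow>
     \<Phi> \<in> measurable M L \<and> h \<in> borel_measurable M \<and> (\<forall>s\<in>space M. 0 \<le> h s) \<and>
     \<Phi> ` space M = space L \<and>
     (\<forall>t\<in>T. AE s in M. g t s = U (f t) s \<and> U (f t) s = h s * f t (\<Phi> s)) \<and>
     L = distr (density M (\<lambda>s. ennreal (h s powr \<alpha>))) L \<Phi>"

end

theory Submission
  imports Defs
begin

text \<open>
  Write \<open>L\<close> for the space carrying the minimal family, \<open>D\<close> for its closed max-span and \<open>f0\<close> for an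
  element of \<open>D\<close> of full support. The proof compares the laws of two families of ratios and needs no
  theory of set isomorphisms.

  A max-linear isometry \<open>W\<close> on a set of functions closed under weighted maxima preserves
  \<open>\<integral> max H (b * f0) ^ \<alpha>\<close> for every \<open>H\<close> in that set and every \<open>b > 0\<close>. Differentiating in \<open>b ^ \<alpha>\<close>
  gives the mass of the event \<open>H < f0\<close> under the measure with density \<open>f0 ^ \<alpha>\<close>. When \<open>H\<close> runs through finite
  maxima, these events are the finite-dimensional orthants for the ratios \<open>F / f0\<close>. Hence the family
  \<open>(F / f0)\<close> has the same law under \<open>f0 ^ \<alpha> dL\<close> as the family \<open>(W F / W f0)\<close> under
  \<open>(W f0) ^ \<alpha> dM\<close>; this is \<open>max_isometry_ratio_law\<close>.

  Minimality says that the ratios of the family generate the sigma-field of \<open>L\<close> up to null sets, so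
  the point \<open>x\<close> can be recovered from them: \<open>x = \<psi> ((F x / f0 x)\<^sub>F)\<close> almost everywhere for a measurable
  \<open>\<psi>\<close> (\<open>minimal_family_reconstruction\<close>). Put \<open>\<Phi> s = \<psi> ((U F s / U f0 s)\<^sub>F)\<close> and
  \<open>h = U f0 / (f0 \<circ> \<Phi>)\<close>. Almost sure identities between ratios on \<open>L\<close> transfer to \<open>M\<close> by equality of laws,
  which yields \<open>U F = h * (F \<circ> \<Phi>)\<close> on \<open>D\<close> (\<open>max_isometry_point_form\<close>) and identifies the image of
  \<open>h ^ \<alpha> dM\<close> under \<open>\<Phi>\<close> with \<open>L\<close> (\<open>max_isometry_pushforward\<close>). The formula \<open>h * (F \<circ> \<Phi>)\<close> extends \<open>U\<close>
  to all of \<open>L\<^sub>+\<^sup>\<alpha>\<close>. An arbitrary extension \<open>W\<close> obeys the same law equality, now with the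
  ratios of all functions in \<open>L\<^sub>+\<^sup>\<alpha>\<close>, while \<open>\<Phi>\<close> and \<open>h\<close> only depend on \<open>W\<close> restricted to \<open>D\<close>; so it is
  given by the same formula. This is the uniqueness in (i). Any other pair \<open>\<Phi>'\<close>, \<open>h'\<close> defines a
  further extension, because \<open>U\<close> is determined on \<open>D\<close> by its values on the generators, and evaluating
  both formulas at indicators of half-lines gives \<open>\<Phi>' = \<Phi>\<close> where \<open>h > 0\<close>.

  It remains to make \<open>\<Phi>\<close> onto. Integer points have positive mass, so they are attained. Points of
  \<open>(0,1)\<close> can be missed, and \<open>\<Phi>\<close> is changed on a null set (\<open>surjective_modification\<close>): inner
  regularity on the graph of \<open>\<Phi>\<close> gives a set \<open>K\<close> whose image is compact of positive Lebesgue measure, this image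
  contains a null set that some Borel function maps onto \<open>(0,1)\<close>, and \<open>\<Phi>\<close> is redefined on
  the preimage of this null set in \<open>K\<close>.
\<close>

section \<open>Null sets that map onto the unit interval\<close>

text \<open>The function that jumps by \<open>(1/2) ^ Suc n\<close> at the \<open>n\<close>-th rational increases strictly because the
  rationals are dense, but all of its increase consists of jumps: its range avoids disjoint intervals
  of total length 1. The range is therefore a null set of the cardinality of the continuum.\<close>

lemma strict_mono_pure_jump_function:
  obtains e :: "real \<Rightarrow> real" and l :: "nat \<Rightarrow> real"
  where "strict_mono e" "\<And>y. 0 \<le> e y" "\<And>y. e y \<le> 1"
    "disjoint_family (\<lambda>n. {l n<..l n + (1/2) ^ Suc n})"
    "\<And>n. 0 \<le> l n" "\<And>n. l n + (1/2) ^ Suc n \<le> 1"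
    "\<And>n y. e y \<notin> {l n<..l n + (1/2) ^ Suc n}"
proof -
  define q where "q = from_nat_into (\<rat> :: real set)"
  have "bij_betw q UNIV (\<rat> :: real set)"
    unfolding q_def by (rule bij_betw_from_nat_into[OF countable_rat Rats_infinite])
  then have q_inj: "inj q" and q_range: "range q = \<rat>" by (auto simp: bij_betw_def)
  define w where "w y n = (if q n < y then (1/2::real) ^ Suc n else 0)" for y n
  define e where "e y = (\<Sum>n. w y n)" for y
  have geo: "summable (\<lambda>n. (1/2::real) ^ Suc n)" "(\<Sum>n. (1/2::real) ^ Suc n) = 1"
    using power_half_series by (simp_all add: sums_iff)
  have w_sum: "summable (w y)" for y
    by (rule summable_comparison_test[OF _ geo(1)]) (auto simp: w_def)
  have e_nonneg: "0 \<le> e y" for y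
    unfolding e_def by (rule suminf_nonneg[OF w_sum]) (auto simp: w_def)
  have e_le_1: "e y \<le> 1" for y
  proof -
    have "e y \<le> (\<Sum>n. (1/2::real) ^ Suc n)"
      unfolding e_def by (rule suminf_le[OF _ w_sum geo(1)]) (auto simp: w_def)
    with geo(2) show ?thesis by simp
  qed
  have jump: "e (q n) + (1/2) ^ Suc n \<le> e y" if "q n < y" for n y
  proof -
    have sg: "summable (\<lambda>k. if k = n then (1/2::real) ^ Suc n else 0)" by simp
    have "e (q n) + (1/2) ^ Suc n = (\<Sum>k. w (q n) k + (if k = n then (1/2) ^ Suc n else 0))"
      unfolding e_def using suminf_add[OF w_sum[of "q n"] sg]
        sums_unique[OF sums_single[of n "\<lambda>k. (1/2::real) ^ Suc n"]] by (simp del: power_Suc)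
    also have "\<dots> \<le> e y"
      unfolding e_def
      by (rule suminf_le[OF _ summable_add[OF w_sum sg] w_sum]) (use that in \<open>auto simp: w_def\<close>)
    finally show ?thesis .
  qed
  have e_mono: "e x \<le> e y" if "x \<le> y" for x y
    unfolding e_def by (rule suminf_le[OF _ w_sum w_sum]) (use that in \<open>auto simp: w_def\<close>)
  have rational_between: "\<exists>n. x < q n \<and> q n < y" if "x < y" for x y
    using Rats_dense_in_real[OF that] q_range by (metis imageE)
  have e_strict: "e x < e y" if xy: "x < y" for x y
  proof -
    obtain n where n: "x < q n" "q n < y" using rational_between[OF xy] by auto
    have "e x \<le> e (q n)" using n e_mono by simp
    also have "\<dots> < e (q n) + (1/2) ^ Suc n" by simp
    also have "\<dots> \<le> e y" using n jump by simp
    finally show ?thesis .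
  qed
  \<comment> \<open>A point above \<open>q n\<close> lies above a further rational, so the value
    \<open>e (q n) + (1/2) ^ Suc n\<close> is never attained and the gap may be closed on the right.\<close>
  have jump_strict: "e (q n) + (1/2) ^ Suc n < e y" if "q n < y" for n y
  proof -
    obtain z where "q n < z" "z < y" using dense[OF \<open>q n < y\<close>] by auto
    then show ?thesis using jump[of n z] e_strict[of z y] by simp
  qed
  have notin: "e y \<notin> {e (q n)<..e (q n) + (1/2) ^ Suc n}" for n y
    using e_mono[of y "q n"] jump_strict[of n y] by (cases "q n < y") auto
  have disj: "disjoint_family (\<lambda>n. {e (q n)<..e (q n) + (1/2) ^ Suc n})"
    unfolding disjoint_family_on_def
  proof (intro ballI impI)
    fix m n :: nat assume "m \<noteq> n"
    then have "q m < q n \<or> q n < q m" using q_inj by (meson injD linorder_neqE)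
    then show "{e (q m)<..e (q m) + (1/2) ^ Suc m} \<inter> {e (q n)<..e (q n) + (1/2) ^ Suc n} = {}"
      using jump[of m "q n"] jump[of n "q m"] by fastforce
  qed
  have le1: "e (q n) + (1/2) ^ Suc n \<le> 1" for n
    using jump[of n "q n + 1"] e_le_1[of "q n + 1"] by simp
  show thesis
    by (rule that[of e "\<lambda>n. e (q n)"])
      (use e_strict e_nonneg e_le_1 disj le1 notin in \<open>auto simp: strict_mono_def\<close>)
qed

text \<open>The distribution function \<open>F\<close> of Lebesgue measure on \<open>D\<close> turns that measure into a uniform one and
  maps \<open>D\<close> onto an interval \<open>[0,d]\<close>. So the points of \<open>D\<close> at which \<open>F\<close> avoids the scaled gaps of a pure
  jump function \<open>e\<close> form a null set, on which \<open>F\<close> still takes every value \<open>d * e y\<close>; the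
  generalised inverse of \<open>e\<close> recovers \<open>y\<close> from it.\<close>

lemma compact_positive_measure_null_surjection:
  fixes D :: "real set"
  assumes D: "compact D" and pos: "0 < emeasure lborel D"
  obtains C c where "C \<subseteq> D" "C \<in> sets borel" "emeasure lborel C = 0"
    "c \<in> borel_measurable borel" "{0<..<1::real} \<subseteq> c ` C"
proof -
  have D_borel [measurable]: "D \<in> sets borel" using D by (simp add: borel_compact)
  have D_fin: "emeasure lborel D < \<infinity>"
    using compact_imp_bounded[OF D] emeasure_bounded_finite by simp
  define d where "d = measure lborel D"
  define F where "F x = measure lborel (D \<inter> {..x})" for x
  have d_em: "emeasure lborel D = ennreal d"
    unfolding d_def using D_fin by (simp add: emeasure_eq_ennreal_measure)
  have D_fm: "D \<in> fmeasurable lborel" using D_fin by (intro fmeasurableI) auto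
  have fm: "D \<inter> {..x} \<in> fmeasurable lborel" for x
    by (rule fmeasurableI2[OF D_fm]) auto
  have d_pos: "0 < d" using pos d_em by simp
  have F_mono: "F x \<le> F y" if "x \<le> y" for x y
    unfolding F_def using that fm by (intro measure_mono_fmeasurable) auto
  have F_lip: "F y \<le> F x + (y - x)" if "x \<le> y" for x y
  proof -
    have "F y \<le> measure lborel ((D \<inter> {..x}) \<union> {x..y})"
      unfolding F_def
      using fm[of x] by (intro measure_mono_fmeasurable fmeasurable.Un)
        (auto intro!: fmeasurableI simp: emeasure_lborel_Icc_eq)
    also have "\<dots> \<le> F x + measure lborel {x..y}"
      unfolding F_def using fm[of x] by (intro measure_Un_le) auto
    finally show ?thesis using that by simp
  qed
  have F_cont: "continuous_on A F" for A
  proof (rule lipschitz_on_continuous_on[of 1])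
    show "1-lipschitz_on A F"
      by (rule lipschitz_onI)
        (smt (verit, best) F_lip F_mono dist_real_def, simp)
  qed
  obtain r where r: "D \<subseteq> {-r..r}" "0 < r"
    using compact_imp_bounded[OF D] unfolding bounded_pos real_norm_def
    by (smt (verit) atLeastAtMost_iff subsetI)
  have F_low: "F (- r - 1) = 0"
  proof -
    have "D \<inter> {..- r - 1} = {}" using r by auto
    then show ?thesis unfolding F_def by (simp only: measure_empty)
  qed
  have F_high: "F r = d"
  proof -
    have "D \<inter> {..r} = D" using r by auto
    then show ?thesis unfolding F_def d_def by simp
  qed
  have F_meas [measurable]: "F \<in> borel_measurable borel"
    by (rule borel_measurable_mono) (simp add: F_mono mono_def)
  have F_le: "F x \<le> d" for x
    unfolding F_def d_def using D_fm by (intro measure_mono_fmeasurable) auto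
  have ivt: "\<exists>x. F x = y" if "0 \<le> y" "y \<le> d" for y
    using IVT'[of F "- r - 1" y r] F_low F_high that r F_cont by auto
  \<comment> \<open>The law of \<open>F\<close> under Lebesgue measure on \<open>D\<close> is uniform on \<open>(0,d]\<close>.\<close>
  have sub: "measure lborel (D \<inter> {x. F x \<le> a}) = a" if a: "0 \<le> a" "a \<le> d" for a
  proof (cases "a = d")
    case True
    then show ?thesis using F_le d_def by (simp add: Int_absorb2 subset_iff)
  next
    case False
    with a have ad: "a < d" by simp
    define Z where "Z = {x. F x \<le> a}"
    have ne: "Z \<noteq> {}" using ivt[OF a] by (auto simp: Z_def)
    have bdd: "bdd_above Z"
      by (rule bdd_aboveI[of _ r]) (smt (verit) F_high F_mono Z_def ad mem_Collect_eq)
    have cl: "closed Z"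
      unfolding Z_def by (intro closed_Collect_le F_cont continuous_on_const)
    have sup: "Sup Z \<in> Z" by (rule closed_contains_Sup[OF ne bdd cl])
    have Zeq: "Z = {..Sup Z}"
      using sup F_mono cSup_upper[OF _ bdd] unfolding Z_def by (auto intro: order_trans)
    obtain x where x: "F x = a" using ivt[OF a] by auto
    have "F (Sup Z) = a"
      using sup x F_mono[of x "Sup Z"] cSup_upper[OF _ bdd, of x] by (auto simp: Z_def)
    moreover have "D \<inter> {x. F x \<le> a} = D \<inter> {..Sup Z}" using Zeq unfolding Z_def by (rule arg_cong)
    ultimately show ?thesis unfolding F_def by simp
  qed
  have slab: "emeasure lborel (D \<inter> {x. a < F x \<and> F x \<le> b}) = ennreal (b - a)"
    if "0 \<le> a" "a \<le> b" "b \<le> d" for a b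
  proof -
    have fmS: "D \<inter> {x. F x \<le> t} \<in> fmeasurable lborel" for t
      by (rule fmeasurableI2[OF D_fm]) auto
    have eq: "D \<inter> {x. a < F x \<and> F x \<le> b} = (D \<inter> {x. F x \<le> b}) - (D \<inter> {x. F x \<le> a})"
      by auto
    have "measure lborel (D \<inter> {x. a < F x \<and> F x \<le> b}) = b - a"
      unfolding eq
      using measurable_measure_Diff[OF fmS[of b], of "D \<inter> {x. F x \<le> a}"] fmS that sub[of a] sub[of b]
      by fastforce
    moreover have "D \<inter> {x. a < F x \<and> F x \<le> b} \<in> fmeasurable lborel"
      unfolding eq using fmS by (intro fmeasurable.Diff)
    ultimately show ?thesis by (metis emeasure_eq_measure2)
  qed
  obtain e :: "real \<Rightarrow> real" and l :: "nat \<Rightarrow> real"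
    where e: "strict_mono e" "\<And>y. 0 \<le> e y" "\<And>y. e y \<le> 1"
      and dj: "disjoint_family (\<lambda>n. {l n<..l n + (1/2) ^ Suc n})"
      and l: "\<And>n. 0 \<le> l n" "\<And>n. l n + (1/2) ^ Suc n \<le> 1"
      and avoid: "\<And>n y. e y \<notin> {l n<..l n + (1/2) ^ Suc n}"
    by (rule strict_mono_pure_jump_function, rule that) assumption+
  define gap where "gap n = D \<inter> {x. d * l n < F x \<and> F x \<le> d * (l n + (1/2) ^ Suc n)}" for n
  have gap_meas [measurable]: "gap n \<in> sets borel" for n unfolding gap_def by measurable
  define C where "C = D - (\<Union>n. gap n)"
  have C_borel: "C \<in> sets borel" unfolding C_def by measurable
  have gap_em: "emeasure lborel (gap n) = ennreal (d * (1/2) ^ Suc n)" for n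
  proof -
    have "d * (l n + (1/2) ^ Suc n) \<le> d" using d_pos l(2)[of n] mult_left_le[of _ d] by simp
    moreover have "d * l n \<le> d * (l n + (1/2) ^ Suc n)" using d_pos by (intro mult_left_mono) auto
    moreover have "0 \<le> d * l n" using d_pos l(1)[of n] by simp
    ultimately show ?thesis
      unfolding gap_def by (subst slab) (auto simp: algebra_simps)
  qed
  have gap_eq: "x \<in> gap n \<longleftrightarrow> x \<in> D \<and> F x / d \<in> {l n<..l n + (1/2) ^ Suc n}" for x n
    unfolding gap_def using d_pos by (auto simp: pos_less_divide_eq pos_divide_le_eq mult.commute)
  have "disjoint_family gap"
    using dj by (force simp: disjoint_family_on_def gap_eq disjoint_iff)
  then have "emeasure lborel (\<Union>n. gap n) = (\<Sum>n. ennreal (d * (1/2) ^ Suc n))"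
    by (subst suminf_emeasure[symmetric]) (auto simp: gap_em)
  also have "\<dots> = ennreal d"
  proof (rule suminf_ennreal_eq)
    show "(\<lambda>n. d * (1/2) ^ Suc n) sums d" using sums_mult[OF power_half_series, of d] by simp
  qed (use d_pos in auto)
  finally have "emeasure lborel C = 0"
    unfolding C_def using d_em
    by (subst emeasure_Diff) (auto simp: gap_def)
  \<comment> \<open>The element 0 makes the supremum range over a nonempty set without raising it.\<close>
  define A where "A x = {y. 0 < y \<and> y < 1 \<and> d * e y \<le> F x}" for x
  define c where "c x = Sup (insert 0 (A x))" for x
  have A_bdd: "bdd_above (insert 0 (A x))" for x
    by (rule bdd_aboveI[of _ 1]) (auto simp: A_def)
  have "mono c"
    unfolding c_def
    by (intro monoI cSup_subset_mono A_bdd) (auto simp: A_def dest: F_mono)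
  then have c_meas: "c \<in> borel_measurable borel" by (rule borel_measurable_mono)
  have onto: "\<exists>x\<in>C. c x = y" if y: "0 < y" "y < 1" for y
  proof -
    have bnd: "0 < d * e y" "d * e y \<le> d"
      using e(1,2) e(3)[of y] d_pos y
      by (auto simp: strict_mono_def mult_le_cancel_left1 intro!: mult_pos_pos)
        (metis e(2) y(1) order_le_less_trans)
    then obtain z where z: "F z = d * e y" using ivt[of "d * e y"] by auto
    \<comment> \<open>\<open>F\<close> is constant on the complement of \<open>D\<close>, so moving \<open>z\<close> down to the next point of
      \<open>D\<close> keeps the value.\<close>
    have ne: "D \<inter> {..z} \<noteq> {}"
    proof
      assume "D \<inter> {..z} = {}"
      then have "F z = 0" unfolding F_def by (simp only: measure_empty)
      with z bnd show False by simp
    qed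
    have cpt: "compact (D \<inter> {..z})" using D by (simp add: compact_Int_closed)
    obtain x where x: "x \<in> D \<inter> {..z}" and mx: "\<And>u. u \<in> D \<inter> {..z} \<Longrightarrow> u \<le> x"
      using compact_attains_sup[OF cpt ne] by auto
    have "D \<inter> {..x} = D \<inter> {..z}" using x mx by auto
    then have Fx: "F x = d * e y" using z by (simp add: F_def)
    then have "F x / d = e y" using d_pos by simp
    then have "x \<in> C" unfolding C_def using x avoid by (auto simp: gap_eq)
    moreover have "c x = y"
    proof -
      have "insert 0 (A x) = {0} \<union> {0<..y}"
        unfolding A_def Fx using d_pos y e(1) by (auto simp: strict_mono_less_eq)
      moreover have "{0} \<union> {0<..y} = {0..y}" using y by auto
      ultimately show ?thesis unfolding c_def using y by simp
    qed
    ultimately show ?thesis by auto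
  qed
  show thesis
    by (rule that[of C c])
      (use C_borel c_meas \<open>emeasure lborel C = 0\<close> onto in \<open>auto simp: C_def image_iff\<close>, metis)
qed

section \<open>Compact images in standard Borel spaces\<close>

text \<open>The embedding sends a point to its distances from a dense sequence. Completeness of the metric makes the
  image Borel, by a description of it through countably many inequalities.\<close>

lemma standard_borel_embedding:
  fixes M :: "'b measure"
  assumes std: "standard_borel_space M" and ne: "space M \<noteq> {}"
  obtains \<iota> :: "'b \<Rightarrow> nat \<Rightarrow> real"
  where "\<iota> \<in> borel_measurable M" "inj_on \<iota> (space M)" "\<iota> ` space M \<in> sets borel"
    "\<And>A. A \<in> sets M \<Longrightarrow> \<exists>B\<in>sets borel. A = \<iota> -` B \<inter> space M"
proof -
  obtain X where X: "completely_metrizable_space X" "separable_space X" "topspace X = space M"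
    and sM: "sets M = sigma_sets (space M) {V. openin X V}"
    using std unfolding standard_borel_space_def by auto
  obtain S d where "Metric_space S d" and compl: "Metric_space.mcomplete S d"
    and Xeq: "X = Metric_space.mtopology S d"
    using X(1) unfolding completely_metrizable_space_def by auto
  interpret Metric_space S d by fact
  have S: "S = space M" using X(3) Xeq by simp
  obtain C where C: "countable C" "C \<subseteq> S" "mtopology closure_of C = S"
    using X(2) unfolding separable_space_def Xeq by auto
  have C_ne: "C \<noteq> {}" using C(3) ne S by auto
  define p where "p = from_nat_into C"
  have p_C: "range p = C" unfolding p_def using C_ne C(1) by (rule range_from_nat_into)
  have pS [simp]: "p i \<in> S" for i using p_C C(2) by auto
  have near: "\<exists>i. d s (p i) < r" if s: "s \<in> S" and r: "0 < r" for s r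
  proof -
    have "s \<in> mtopology closure_of C" using C(3) s by simp
    then obtain y where "y \<in> C" "y \<in> mball s r" using r unfolding metric_closure_of by auto
    then show ?thesis using p_C by (metis in_mball rangeE)
  qed
  have op: "V \<in> sets M" if "openin mtopology V" for V
    using that sM Xeq by auto
  define \<iota> where "\<iota> s i = d s (p i)" for s i
  have ball_eq: "mball (p i) r = {s \<in> space M. \<iota> s i < r}" for i r
    unfolding \<iota>_def S by (auto simp: commute S[symmetric])
  have \<iota>_meas: "\<iota> \<in> borel_measurable M"
  proof (rule measurable_coordinatewise_then_product)
    fix i
    show "(\<lambda>s. \<iota> s i) \<in> borel_measurable M"
      unfolding borel_measurable_iff_less using ball_eq[of i] op[OF openin_mball] by metis
  qed
  have \<iota>_inj: "inj_on \<iota> (space M)"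
  proof (rule inj_onI)
    fix s t assume st: "s \<in> space M" "t \<in> space M" "\<iota> s = \<iota> t"
    have "d s t < r" if r: "0 < r" for r
    proof -
      obtain i where i: "d s (p i) < r / 2" using near[of s "r/2"] st S r by auto
      have "d t (p i) = d s (p i)" using st(3) unfolding \<iota>_def by metis
      then show ?thesis using triangle[of s "p i" t] pS[of i] i st S by (simp add: commute)
    qed
    then have "d s t = 0" using nonneg[of s t] by (metis less_irrefl order_less_le)
    then show "s = t" using st S by simp
  qed
  \<comment> \<open>The image consists of the sequences that satisfy the triangle inequalities of a distance
    function and come arbitrarily close to zero: completeness supplies the point.\<close>
  have image: "\<iota> ` space M = {\<omega>. (\<forall>i j. \<bar>\<omega> i - \<omega> j\<bar> \<le> d (p i) (p j) \<and> d (p i) (p j) \<le> \<omega> i + \<omega> j)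
      \<and> (\<forall>m::nat. \<exists>i. \<omega> i < 1 / Suc m)}" (is "_ = ?G")
  proof (intro equalityI subsetI)
    fix \<omega> assume "\<omega> \<in> \<iota> ` space M"
    then obtain s where s: "s \<in> S" "\<omega> = \<iota> s" using S by auto
    have "\<bar>\<omega> i - \<omega> j\<bar> \<le> d (p i) (p j) \<and> d (p i) (p j) \<le> \<omega> i + \<omega> j" for i j
      using triangle[of s "p i" "p j"] triangle[of s "p j" "p i"] triangle[of "p i" s "p j"] s
      by (simp add: \<iota>_def commute abs_le_iff algebra_simps)
    moreover have "\<exists>i. \<omega> i < 1 / Suc m" for m
      using near[OF s(1), of "1 / Suc m"] s(2) by (simp add: \<iota>_def)
    ultimately show "\<omega> \<in> ?G" by auto
  next
    fix \<omega> assume w: "\<omega> \<in> ?G"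
    then have "\<forall>m::nat. \<exists>i. \<omega> i < 1 / Suc m" by simp
    then obtain k where k: "\<And>m::nat. \<omega> (k m) < 1 / Suc m" by metis
    have tri: "\<bar>\<omega> i - \<omega> j\<bar> \<le> d (p i) (p j)" "d (p i) (p j) \<le> \<omega> i + \<omega> j" for i j
      using w by auto
    have small: "\<omega> (k n) < \<epsilon>" if "0 < \<epsilon>" "N \<le> n" "1 / real (Suc N) < \<epsilon>" for n N \<epsilon>
    proof -
      have "1 / real (Suc n) \<le> 1 / real (Suc N)" using that(2) by (simp add: frac_le)
      then show ?thesis using k[of n] that by simp
    qed
    have "MCauchy (\<lambda>m. p (k m))"
      unfolding MCauchy_def
    proof (intro conjI allI impI)
      fix \<epsilon> :: real assume e: "0 < \<epsilon>"
      then obtain N where N: "1 / real (Suc N) < \<epsilon> / 2" using nat_approx_posE[of "\<epsilon>/2"] by auto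
      show "\<exists>N. \<forall>n n'. N \<le> n \<longrightarrow> N \<le> n' \<longrightarrow> d (p (k n)) (p (k n')) < \<epsilon>"
      proof (intro exI allI impI)
        fix n n' assume "N \<le> n" "N \<le> n'"
        then have "\<omega> (k n) < \<epsilon> / 2" "\<omega> (k n') < \<epsilon> / 2" using small[of "\<epsilon>/2" N] e N by auto
        then show "d (p (k n)) (p (k n')) < \<epsilon>" using tri(2)[of "k n" "k n'"] by simp
      qed
    qed auto
    then obtain s where s: "limitin mtopology (\<lambda>m. p (k m)) s sequentially"
      using compl unfolding mcomplete_def by auto
    then have sS: "s \<in> S" by (simp add: limitin_mspace)
    have "\<omega> j = \<iota> s j" for j
    proof -
      have "\<bar>\<omega> j - \<iota> s j\<bar> < \<epsilon>" if e: "0 < \<epsilon>" for \<epsilon>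
      proof -
        obtain N where N: "1 / real (Suc N) < \<epsilon> / 3" using nat_approx_posE[of "\<epsilon>/3"] e by auto
        obtain N' where N': "\<And>n. n \<ge> N' \<Longrightarrow> d (p (k n)) s < \<epsilon> / 3"
          using s e unfolding limit_metric_sequentially by (metis divide_pos_pos zero_less_numeral)
        define n where "n = max N N'"
        have 1: "\<omega> (k n) < \<epsilon> / 3" using small[of "\<epsilon>/3" N n] e N by (simp add: n_def)
        have 2: "d (p (k n)) s < \<epsilon> / 3" using N'[of n] by (simp add: n_def)
        have 3: "\<omega> j \<le> d (p (k n)) (p j) + \<omega> (k n)" "d (p (k n)) (p j) \<le> \<omega> j + \<omega> (k n)"
          using tri[of "k n" j] by (auto simp: abs_le_iff)
        have 4: "d s (p j) \<le> d (p (k n)) s + d (p (k n)) (p j)"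
                "d (p (k n)) (p j) \<le> d (p (k n)) s + d s (p j)"
          using triangle[of s "p (k n)" "p j"] triangle[of "p (k n)" s "p j"] sS
          by (simp_all add: commute)
        show ?thesis using 1 2 3 4 e unfolding \<iota>_def abs_less_iff by linarith
      qed
      then have "\<bar>\<omega> j - \<iota> s j\<bar> = 0" by (metis abs_ge_zero less_irrefl order_less_le)
      then show ?thesis by simp
    qed
    then show "\<omega> \<in> \<iota> ` space M" using sS S by auto
  qed
  have proj [measurable]: "(\<lambda>\<omega>::nat \<Rightarrow> real. \<omega> i) \<in> borel_measurable borel" for i
    by (intro borel_measurable_continuous_onI continuous_on_coordinatewise_then_product
      continuous_on_product_coordinates)
  have G_meas: "?G \<in> sets borel" by measurable
  have pull: "\<exists>B\<in>sets borel. A = \<iota> -` B \<inter> space M" if A: "A \<in> sets M" for A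
  proof -
    let ?V = "vimage_algebra (space M) \<iota> borel"
    have V: "sets ?V = {\<iota> -` B \<inter> space M | B. B \<in> sets borel}"
      by (rule sets_vimage_algebra2) simp
    have opV: "W \<in> sets ?V" if W: "openin X W" for W
    proof -
      have W': "W \<subseteq> S" "\<And>x. x \<in> W \<Longrightarrow> \<exists>r>0. mball x r \<subseteq> W"
        using W unfolding Xeq openin_mtopology by auto
      define J where "J = {(i, m::nat). mball (p i) (1 / Suc m) \<subseteq> W}"
      have "W = (\<Union>(i,m)\<in>J. mball (p i) (1 / Suc m))"
      proof (intro equalityI subsetI)
        fix x assume x: "x \<in> W"
        then obtain r where r: "0 < r" "mball x r \<subseteq> W" using W'(2) by auto
        obtain m where m: "1 / real (Suc m) < r / 2" using nat_approx_posE[of "r/2"] r by auto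
        have xS: "x \<in> S" using x W' by auto
        obtain i where i: "d x (p i) < 1 / Suc m" using near[OF xS, of "1 / Suc m"] by auto
        have "mball (p i) (1 / Suc m) \<subseteq> W"
        proof (rule subset_trans[OF _ r(2)], rule subsetI)
          fix y assume y: "y \<in> mball (p i) (1 / Suc m)"
          then have "d x y \<le> d x (p i) + d (p i) y" using triangle xS by simp
          moreover have "d (p i) y < 1 / Suc m" "y \<in> S" using y by (simp_all only: in_mball)
          ultimately have "d x y < r" using i m by linarith
          then show "y \<in> mball x r" using \<open>y \<in> S\<close> xS by simp
        qed
        then have "(i, m) \<in> J" unfolding J_def by simp
        moreover have "x \<in> mball (p i) (1 / Suc m)" using i xS by (simp add: commute)
        ultimately show "x \<in> (\<Union>(i,m)\<in>J. mball (p i) (1 / Suc m))" by fast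
      qed (auto simp: J_def)
      also have "\<dots> \<in> sets ?V"
      proof (rule sets.countable_UN'')
        show "countable J" by simp
        fix im assume "im \<in> J"
        obtain i m where im: "im = (i, m)" by (cases im)
        have "mball (p i) (1 / Suc m) = \<iota> -` {\<omega>. \<omega> i < 1 / Suc m} \<inter> space M"
          using ball_eq by auto
        moreover have "{\<omega>::nat\<Rightarrow>real. \<omega> i < 1 / Suc m} \<in> sets borel" by measurable
        ultimately show "(case im of (i, m) \<Rightarrow> mball (p i) (1 / Suc m)) \<in> sets ?V"
          unfolding V im prod.case by blast
      qed
      finally show ?thesis .
    qed
    have "sets M \<subseteq> sets ?V"
      unfolding sM using opV sets.sigma_sets_subset[of "{V. openin X V}" ?V] by auto
    then show ?thesis using A V by auto
  qed
  show thesis by (rule that[OF \<iota>_meas \<iota>_inj _ pull]) (use G_meas image in auto)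
qed

text \<open>A form of Lusin's theorem. Inner regularity is applied not to \<open>E\<close> but to the graph of \<open>\<Phi>\<close> over
  \<open>E\<close>, embedded in a Polish vector space: on a compact part of the graph the value of \<open>\<Phi>\<close> is a
  coordinate, hence continuous.\<close>

lemma standard_borel_compact_image:
  fixes M :: "'b measure" and \<Phi> :: "'b \<Rightarrow> real"
  assumes std: "standard_borel_space M"
    and fin: "finite_measure \<kappa>" and sets_\<kappa>: "sets \<kappa> = sets M"
    and \<Phi>: "\<Phi> \<in> borel_measurable M" and E: "E \<in> sets M" and pos: "0 < emeasure \<kappa> E"
  obtains K where "K \<in> sets M" "K \<subseteq> E" "compact (\<Phi> ` K)" "0 < emeasure \<kappa> K"
proof -
  have "E \<noteq> {}" using pos by auto
  then obtain s0 where s0: "s0 \<in> space M" using sets.sets_into_space[OF E] by auto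
  then have ne: "space M \<noteq> {}" by auto
  obtain \<iota> :: "'b \<Rightarrow> nat \<Rightarrow> real"
    where \<iota>: "\<iota> \<in> borel_measurable M" "inj_on \<iota> (space M)" and G: "\<iota> ` space M \<in> sets borel"
      and pull: "\<And>A. A \<in> sets M \<Longrightarrow> \<exists>B\<in>sets borel. A = \<iota> -` B \<inter> space M"
    by (rule standard_borel_embedding[OF std ne], rule that) assumption+
  \<comment> \<open>A Borel left inverse of the embedding, constant off its image.\<close>
  define j where "j y = (if y \<in> \<iota> ` space M then inv_into (space M) \<iota> y else s0)" for y
  have j_\<iota> [simp]: "j (\<iota> s) = s" if "s \<in> space M" for s
    unfolding j_def using that \<iota>(2) by simp
  have j_meas: "j \<in> measurable borel M"
  proof (rule measurableI)
    show "j y \<in> space M" for y unfolding j_def using s0 by (auto intro: inv_into_into)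
    fix A assume A: "A \<in> sets M"
    then obtain B where B: "B \<in> sets borel" "A = \<iota> -` B \<inter> space M" using pull by blast
    have "j y \<in> A \<longleftrightarrow> (if y \<in> \<iota> ` space M then y \<in> B else s0 \<in> A)" for y
      using B by (cases "y \<in> \<iota> ` space M") (auto, auto simp: j_def)
    note iff = this
    have "j -` A \<inter> space borel = (B \<inter> \<iota> ` space M) \<union> (if s0 \<in> A then - (\<iota> ` space M) else {})"
    proof (rule set_eqI)
      fix y
      show "y \<in> j -` A \<inter> space borel \<longleftrightarrow>
          y \<in> (B \<inter> \<iota> ` space M) \<union> (if s0 \<in> A then - (\<iota> ` space M) else {})"
        using iff[of y] by (cases "y \<in> \<iota> ` space M"; cases "s0 \<in> A") simp_all
    qed
    then show "j -` A \<inter> space borel \<in> sets borel" using B(1) G by auto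
  qed
  define \<Gamma> where "\<Gamma> s = (\<iota> s, \<Phi> s)" for s
  have \<Gamma>_meas: "\<Gamma> \<in> measurable \<kappa> borel"
    unfolding \<Gamma>_def using \<iota>(1) \<Phi> sets_\<kappa> by (simp add: measurable_cong_sets[OF sets_\<kappa> refl])
  have sp: "space \<kappa> = space M" using sets_\<kappa> by (rule sets_eq_imp_space_eq)
  define H where "H = {q :: (nat \<Rightarrow> real) \<times> real.
     fst q \<in> \<iota> ` space M \<and> snd q = \<Phi> (j (fst q)) \<and> j (fst q) \<in> E}"
  have f1: "fst \<in> borel_measurable (borel :: ((nat \<Rightarrow> real) \<times> real) measure)"
    by (intro borel_measurable_continuous_onI continuous_intros)
  have f2: "snd \<in> borel_measurable (borel :: ((nat \<Rightarrow> real) \<times> real) measure)"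
    by (intro borel_measurable_continuous_onI continuous_intros)
  have jf: "(\<lambda>q :: (nat \<Rightarrow> real) \<times> real. j (fst q)) \<in> measurable borel M"
    using f1 j_meas by (rule measurable_compose)
  have \<Phi>jf: "(\<lambda>q :: (nat \<Rightarrow> real) \<times> real. \<Phi> (j (fst q))) \<in> borel_measurable borel"
    using jf \<Phi> by (rule measurable_compose)
  have H: "H \<in> sets borel"
  proof -
    have "H = (fst -` (\<iota> ` space M) \<inter> space borel)
        \<inter> {q \<in> space borel. snd q = \<Phi> (j (fst q))} \<inter> ((\<lambda>q. j (fst q)) -` E \<inter> space borel)"
      unfolding H_def by auto
    then show ?thesis
      by (rule ssubst) (intro sets.Int measurable_sets[OF f1 G] measurable_sets[OF jf E]
        borel_measurable_eq[OF f2 \<Phi>jf])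
  qed
  have \<Gamma>_H: "\<Gamma> s \<in> H \<longleftrightarrow> s \<in> E" if "s \<in> space M" for s
    using that by (simp add: H_def \<Gamma>_def)
  have H_image: "q \<in> \<Gamma> ` E" if q: "q \<in> H" for q
  proof -
    obtain s where s: "s \<in> space M" "fst q = \<iota> s" using q by (auto simp: H_def)
    then have "s \<in> E" "q = \<Gamma> s" using q by (simp_all add: H_def \<Gamma>_def prod_eq_iff)
    then show ?thesis by blast
  qed
  have H_pre: "\<Gamma> -` H \<inter> space M = E"
    using sets.sets_into_space[OF E] \<Gamma>_H by blast
  define \<nu> where "\<nu> = distr \<kappa> borel \<Gamma>"
  interpret \<kappa>: finite_measure \<kappa> by fact
  interpret \<nu>: finite_measure \<nu> unfolding \<nu>_def by (rule \<kappa>.finite_measure_distr[OF \<Gamma>_meas])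
  have "emeasure \<nu> H = emeasure \<kappa> E"
    unfolding \<nu>_def by (subst emeasure_distr[OF \<Gamma>_meas H]) (simp add: sp H_pre)
  then have "0 < (SUP K \<in> {K. K \<subseteq> H \<and> compact K}. emeasure \<nu> K)"
    using inner_regular[of \<nu> H] H pos \<nu>.emeasure_finite by (simp add: \<nu>_def)
  then obtain Q where Q: "Q \<subseteq> H" "compact Q" "0 < emeasure \<nu> Q"
    by (auto simp: less_SUP_iff)
  have Qb: "Q \<in> sets borel" using Q(2) by (rule borel_compact)
  define K where "K = \<Gamma> -` Q \<inter> space M"
  have KE: "K \<subseteq> E" unfolding K_def using Q(1) H_pre by auto
  show thesis
  proof (rule that[of K])
    show "K \<in> sets M" unfolding K_def using measurable_sets[OF \<Gamma>_meas Qb] sets_\<kappa> sp by simp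
    show "K \<subseteq> E" by fact
    have "\<Phi> ` K = snd ` Q"
    proof
      show "\<Phi> ` K \<subseteq> snd ` Q" by (force simp: K_def \<Gamma>_def)
      show "snd ` Q \<subseteq> \<Phi> ` K"
      proof
        fix y assume "y \<in> snd ` Q"
        then obtain q where q: "q \<in> Q" "y = snd q" by auto
        then obtain s where s: "s \<in> E" "q = \<Gamma> s" using Q(1) H_image by blast
        then have "s \<in> K" "y = \<Phi> s"
          using q sets.sets_into_space[OF E] by (auto simp: K_def \<Gamma>_def)
        then show "y \<in> \<Phi> ` K" by blast
      qed
    qed
    then show "compact (\<Phi> ` K)"
      using compact_continuous_image[OF continuous_on_snd[OF continuous_on_id] Q(2)] by simp
    show "0 < emeasure \<kappa> K"
      using Q(3) unfolding \<nu>_def K_def by (simp add: emeasure_distr[OF \<Gamma>_meas Qb] sp)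
  qed
qed

section \<open>Making a point map surjective\<close>

lemma measurable_lambda_IN_iff:
  "\<Phi> \<in> measurable M (lambda_IN I N) \<longleftrightarrow> \<Phi> \<in> borel_measurable M \<and> \<Phi> \<in> space M \<rightarrow> S_IN I N"
  using measurable_cong_sets[OF refl sets_lambda_IN, of M I N]
  by (auto simp: measurable_restrict_space2_iff)

lemma sets_lambda_IN_iff: "A \<in> sets (restrict_space borel (S_IN I N)) \<longleftrightarrow> A \<in> sets borel \<and> A \<subseteq> S_IN I N"
  using S_IN_borel[of I N] by (auto simp: sets_restrict_space_iff)

lemma emeasure_lambda_IN_unit:
  assumes "I \<noteq> 0" "A \<in> sets borel" "A \<subseteq> {0<..<1}"
  shows "emeasure (lambda_IN I N) A = emeasure lborel A"
proof -
  have "A \<inter> range real = {}"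
  proof -
    have "real n \<notin> {0<..<1}" for n by auto
    then show ?thesis using assms(3) by blast
  qed
  moreover have "A \<in> sets (lambda_IN I N)"
  proof -
    have "{0<..<1} \<subseteq> S_IN I N" using assms(1) by (auto simp: S_IN_def)
    then show ?thesis using assms by (auto simp: sets_lambda_IN_iff)
  qed
  ultimately show ?thesis
    using assms(3) by (simp add: emeasure_lambda_IN Int_absorb2)
qed

lemma emeasure_lambda_IN_atom:
  assumes "real n \<in> S_IN I N"
  shows "emeasure (lambda_IN I N) {real n} = 1"
proof -
  have "{real n} \<in> sets (lambda_IN I N)" using assms by (simp add: sets_lambda_IN_iff)
  moreover have "{real n} \<inter> {0<..<1} = {}" "{real n} \<inter> range real = {real n}" by auto
  ultimately show ?thesis by (simp add: emeasure_lambda_IN)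
qed

text \<open>Integer points are atoms of mass 1, so \<open>\<Phi>\<close> attains them. For the points of \<open>(0,1)\<close> the measure \<open>w dM\<close> is restricted to
  the part \<open>E'\<close> lying over \<open>(0,1)\<close>, which has total mass 1; this makes it finite and lets inner regularity apply.
  Restricting further to \<open>w > 0\<close> turns null sets of \<open>w dM\<close> into null sets of \<open>M\<close>.\<close>

lemma surjective_modification:
  fixes M :: "'b measure" and \<Phi> :: "'b \<Rightarrow> real" and w :: "'b \<Rightarrow> ennreal"
  assumes std: "standard_borel_space M"
    and \<Phi>: "\<Phi> \<in> measurable M (lambda_IN I N)" and w: "w \<in> borel_measurable M"
    and law: "lambda_IN I N = distr (density M w) (lambda_IN I N) \<Phi>"
  obtains \<Psi> where "\<Psi> \<in> measurable M (lambda_IN I N)" "AE s in M. \<Psi> s = \<Phi> s"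
    "\<Psi> ` space M = S_IN I N"
proof -
  let ?L = "lambda_IN I N" and ?\<nu> = "density M w"
  have \<Phi>b: "\<Phi> \<in> borel_measurable M" and \<Phi>S: "\<And>s. s \<in> space M \<Longrightarrow> \<Phi> s \<in> S_IN I N"
    using \<Phi> unfolding measurable_lambda_IN_iff by auto
  have \<Phi>': "\<Phi> \<in> measurable ?\<nu> ?L" using \<Phi> by simp
  have push: "emeasure ?\<nu> (\<Phi> -` A \<inter> space M) = emeasure ?L A" if "A \<in> sets ?L" for A
  proof -
    have "emeasure ?L A = emeasure (distr ?\<nu> ?L \<Phi>) A" using law by (rule arg_cong)
    also have "\<dots> = emeasure ?\<nu> (\<Phi> -` A \<inter> space ?\<nu>)" by (rule emeasure_distr[OF \<Phi>' that])
    finally show ?thesis by (simp only: space_density)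
  qed
  have atom: "\<exists>s\<in>space M. \<Phi> s = real n" if "real n \<in> S_IN I N" for n
  proof (rule ccontr)
    assume "\<not> ?thesis"
    then have "\<Phi> -` {real n} \<inter> space M = {}" by auto
    moreover have "{real n} \<in> sets ?L" using that by (simp add: sets_lambda_IN_iff)
    ultimately have "emeasure ?L {real n} = 0" using push[of "{real n}"] by (simp only: emeasure_empty)
    then show False using emeasure_lambda_IN_atom[OF that] by simp
  qed
  show thesis
  proof (cases "I = 0")
    case True
    have "\<Phi> ` space M = S_IN I N"
    proof
      show "S_IN I N \<subseteq> \<Phi> ` space M"
      proof
        fix x assume x: "x \<in> S_IN I N"
        then obtain n where n: "x = real n" using True by (auto simp: S_IN_def)
        then obtain s where "s \<in> space M" "\<Phi> s = x" using atom[of n] x by auto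
        then show "x \<in> \<Phi> ` space M" by blast
      qed
    qed (use \<Phi>S in auto)
    then show thesis using that[of \<Phi>] \<Phi> by simp
  next
    case I: False
    define E' where "E' = \<Phi> -` {0<..<1} \<inter> space M"
    define E where "E = {s \<in> E'. 0 < w s}"
    have unit_S: "{0<..<1} \<subseteq> S_IN I N" using I by (auto simp: S_IN_def)
    have E': "E' \<in> sets M" unfolding E'_def using \<Phi>b by (rule measurable_sets) simp
    have E: "E \<in> sets M"
    proof -
      have "E = E' \<inter> {s \<in> space M. 0 < w s}"
        unfolding E_def using sets.sets_into_space[OF E'] by auto
      moreover have "{s \<in> space M. 0 < w s} \<in> sets M" using w by measurable
      ultimately show ?thesis using E' by simp
    qed
    define \<kappa> where "\<kappa> = density M (\<lambda>s. w s * indicator E' s)"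
    have \<kappa>_sets: "sets \<kappa> = sets M" and \<kappa>_space: "space \<kappa> = space M" by (simp_all add: \<kappa>_def)
    have \<kappa>_em: "emeasure \<kappa> A = emeasure ?\<nu> (E' \<inter> A)" if "A \<in> sets M" for A
      using that E' w unfolding \<kappa>_def
      by (simp add: emeasure_density mult.assoc indicator_inter_arith)
    have E'_one: "emeasure ?\<nu> E' = 1"
      unfolding E'_def using unit_S I
      by (subst push) (auto simp: sets_lambda_IN_iff emeasure_lambda_IN_unit)
    have \<kappa>_fin: "finite_measure \<kappa>"
    proof (rule finite_measureI)
      have "emeasure \<kappa> (space \<kappa>) = emeasure ?\<nu> E'"
        using \<kappa>_em[OF sets.top] sets.sets_into_space[OF E'] by (simp add: \<kappa>_space Int_absorb2)
      then show "emeasure \<kappa> (space \<kappa>) \<noteq> \<infinity>" using E'_one by simp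
    qed
    have "emeasure ?\<nu> E = emeasure ?\<nu> E'"
      unfolding emeasure_density[OF w E] emeasure_density[OF w E']
      by (rule nn_integral_cong) (auto simp: E_def indicator_def zero_less_iff_neq_zero)
    moreover have "E' \<inter> E = E" unfolding E_def by auto
    ultimately have E_pos: "0 < emeasure \<kappa> E" using \<kappa>_em[OF E] E'_one by simp
    obtain K where K: "K \<in> sets M" "K \<subseteq> E" "compact (\<Phi> ` K)" "0 < emeasure \<kappa> K"
      by (rule standard_borel_compact_image[OF std \<kappa>_fin \<kappa>_sets \<Phi>b E E_pos])
    define D where "D = \<Phi> ` K"
    have D_unit: "D \<subseteq> {0<..<1}" using K(2) unfolding D_def E_def E'_def by auto
    have D_borel: "D \<in> sets borel" using K(3) unfolding D_def by (rule borel_compact)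
    have KM: "K \<subseteq> space M" using sets.sets_into_space[OF K(1)] .
    have "emeasure \<kappa> K \<le> emeasure ?\<nu> (\<Phi> -` D \<inter> space M)"
      unfolding \<kappa>_em[OF K(1)] using KM measurable_sets[OF \<Phi>b D_borel]
      by (intro emeasure_mono) (auto simp: D_def)
    also have "\<dots> = emeasure lborel D"
      using D_unit unit_S D_borel I
      by (subst push) (auto simp: sets_lambda_IN_iff emeasure_lambda_IN_unit)
    finally have D_pos: "0 < emeasure lborel D" using K(4) by simp
    obtain C c where C: "C \<subseteq> D" "C \<in> sets borel" "emeasure lborel C = 0"
      and c: "c \<in> borel_measurable borel" "{0<..<1::real} \<subseteq> c ` C"
      by (rule compact_positive_measure_null_surjection[OF K(3)[folded D_def] D_pos])
    define K0 where "K0 = K \<inter> (\<Phi> -` C \<inter> space M)"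
    have K0: "K0 \<in> sets M" unfolding K0_def using K(1) measurable_sets[OF \<Phi>b C(2)] by simp
    have CL: "C \<in> sets ?L" using C D_unit unit_S by (auto simp: sets_lambda_IN_iff)
    have "emeasure ?\<nu> K0 \<le> emeasure ?\<nu> (\<Phi> -` C \<inter> space M)"
      using measurable_sets[OF \<Phi>b C(2)] by (intro emeasure_mono) (auto simp: K0_def)
    also have "\<dots> = 0"
      using C D_unit I by (subst push[OF CL]) (auto simp: emeasure_lambda_IN_unit)
    finally have "K0 \<in> null_sets ?\<nu>" using K0 by (auto simp: null_sets_def)
    then have "AE s in M. s \<in> K0 \<longrightarrow> w s = 0"
      using null_sets_density_iff[OF w] by simp
    then have K0_null: "AE s in M. s \<notin> K0"
      by eventually_elim (use K(2) in \<open>auto simp: K0_def E_def\<close>)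
    define \<Psi> where "\<Psi> s = (if s \<in> K0 \<and> 0 < c (\<Phi> s) \<and> c (\<Phi> s) < 1 then c (\<Phi> s) else \<Phi> s)" for s
    have c\<Phi> [measurable]: "(\<lambda>s. c (\<Phi> s)) \<in> borel_measurable M"
      using \<Phi>b c(1) by (rule measurable_compose)
    note K0 [measurable] \<Phi>b [measurable]
    have \<Psi>_meas: "\<Psi> \<in> measurable M ?L"
      unfolding measurable_lambda_IN_iff
    proof
      show "\<Psi> \<in> borel_measurable M" unfolding \<Psi>_def by measurable
      show "\<Psi> \<in> space M \<rightarrow> S_IN I N" using \<Phi>S unit_S by (auto simp: \<Psi>_def)
    qed
    have \<Psi>_AE: "AE s in M. \<Psi> s = \<Phi> s"
      using K0_null by eventually_elim (simp add: \<Psi>_def)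
    have "\<Psi> ` space M = S_IN I N"
    proof
      show "\<Psi> ` space M \<subseteq> S_IN I N" using \<Phi>S unit_S by (auto simp: \<Psi>_def)
      show "S_IN I N \<subseteq> \<Psi> ` space M"
      proof
        fix x assume x: "x \<in> S_IN I N"
        show "x \<in> \<Psi> ` space M"
        proof (cases "x \<in> {0<..<1}")
          case True
          then obtain y where y: "y \<in> C" "c y = x" using c(2) by blast
          then obtain s where s: "s \<in> K" "\<Phi> s = y" using C(1) unfolding D_def by blast
          then have "s \<in> K0" using y KM by (auto simp: K0_def)
          then have "\<Psi> s = x" using s y True by (simp add: \<Psi>_def)
          then show ?thesis using s KM by blast
        next
          case False
          then obtain n where n: "x = real n" using x by (auto simp: S_IN_def split: if_splits)
          then obtain s where s: "s \<in> space M" "\<Phi> s = x" using atom[of n] x by auto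
          have "s \<notin> K0" using s False K(2) by (auto simp: K0_def E_def E'_def)
          then have "\<Psi> s = x" using s by (simp add: \<Psi>_def)
          then show ?thesis using s by blast
        qed
      qed
    qed
    with \<Psi>_meas \<Psi>_AE show thesis by (rule that)
  qed
qed

section \<open>Identifying measures on products of the real line\<close>

text \<open>Strict orthants are used because the masses of events of the form \<open>H < f0\<close> are what the differentiation
  argument below provides.\<close>

lemma measure_eqI_PiM_real:
  fixes P Q :: "('i \<Rightarrow> real) measure"
  assumes P: "sets P = sets (Pi\<^sub>M K (\<lambda>_. borel))" and Q: "sets Q = sets (Pi\<^sub>M K (\<lambda>_. borel))"
    and fin: "finite_measure P"
    and eq: "\<And>J z. finite J \<Longrightarrow> J \<subseteq> K \<Longrightarrow>
      emeasure P {\<omega> \<in> space P. \<forall>i\<in>J. \<omega> i < z i} = emeasure Q {\<omega> \<in> space Q. \<forall>i\<in>J. \<omega> i < z i}"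
  shows "P = Q"
proof -
  let ?M = "Pi\<^sub>M K (\<lambda>_. borel :: real measure)"
  let ?\<Omega> = "space ?M"
  define E where "E = {{\<omega> \<in> ?\<Omega>. \<forall>i\<in>J. \<omega> i < z i} | J (z :: 'i \<Rightarrow> real). finite J \<and> J \<subseteq> K}"
  have E_Pow: "E \<subseteq> Pow ?\<Omega>" unfolding E_def by auto
  have Int: "Int_stable E"
  proof (rule Int_stableI)
    fix a b assume "a \<in> E" "b \<in> E"
    then obtain J1 z1 J2 z2 where
      a: "a = {\<omega> \<in> ?\<Omega>. \<forall>i\<in>J1. \<omega> i < z1 i}" "finite J1" "J1 \<subseteq> K" and
      b: "b = {\<omega> \<in> ?\<Omega>. \<forall>i\<in>J2. \<omega> i < z2 i}" "finite J2" "J2 \<subseteq> K"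
      unfolding E_def by auto
    define z where "z i = (if i \<in> J1 then if i \<in> J2 then min (z1 i) (z2 i) else z1 i else z2 i)" for i
    have "a \<inter> b = {\<omega> \<in> ?\<Omega>. \<forall>i\<in>J1 \<union> J2. \<omega> i < z i}"
      unfolding a b z_def by (auto split: if_splits)
    then show "a \<inter> b \<in> E"
      unfolding E_def using a b by (intro CollectI exI[of _ "J1 \<union> J2"] exI[of _ z]) simp
  qed
  have sub: "sigma_sets ?\<Omega> E \<subseteq> sets ?M"
  proof (rule sets.sigma_sets_subset, rule subsetI)
    fix a assume "a \<in> E"
    then obtain J z where a: "a = {\<omega> \<in> ?\<Omega>. \<forall>i\<in>J. \<omega> i < z i}" "finite J" "J \<subseteq> K"
      unfolding E_def by auto
    have c: "(\<lambda>\<omega>. \<omega> i) \<in> borel_measurable ?M" if "i \<in> J" for i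
      using that a(3) by (auto intro: measurable_component_singleton)
    show "a \<in> sets ?M"
      unfolding a(1) using c a(2) by (intro sets.sets_Collect_finite_All)
        (auto simp: borel_measurable_iff_less)
  qed
  have gen: "sets ?M = sigma_sets ?\<Omega> E"
  proof
    let ?S = "sigma ?\<Omega> E"
    have sS: "sets ?S = sigma_sets ?\<Omega> E" "space ?S = ?\<Omega>" using E_Pow by simp_all
    have "(\<lambda>\<omega>. \<lambda>i\<in>K. \<omega> i) \<in> measurable ?S ?M"
    proof (rule measurable_restrict)
      fix i assume i: "i \<in> K"
      show "(\<lambda>\<omega>. \<omega> i) \<in> measurable ?S borel"
        unfolding borel_measurable_iff_less
      proof
        fix a :: real
        have "{\<omega> \<in> ?\<Omega>. \<forall>j\<in>{i}. \<omega> j < (\<lambda>_. a) j} \<in> E"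
          unfolding E_def using i by (intro CollectI exI[of _ "{i}"] exI[of _ "\<lambda>_. a"]) simp
        then show "{\<omega> \<in> space ?S. \<omega> i < a} \<in> sets ?S" unfolding sS by auto
      qed
    qed
    then have id: "(\<lambda>\<omega>. \<omega>) \<in> measurable ?S ?M"
    proof (rule measurable_cong[THEN iffD1, rotated])
      fix \<omega> assume "\<omega> \<in> space ?S"
      then show "restrict \<omega> K = \<omega>" unfolding sS by (auto simp: space_PiM PiE_def extensional_restrict)
    qed
    show "sets ?M \<subseteq> sigma_sets ?\<Omega> E"
    proof
      fix A assume A: "A \<in> sets ?M"
      have "(\<lambda>\<omega>. \<omega>) -` A \<inter> space ?S \<in> sets ?S" using id A by (rule measurable_sets)
      moreover have "(\<lambda>\<omega>. \<omega>) -` A \<inter> space ?S = A" using sets.sets_into_space[OF A] sS by auto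
      ultimately show "A \<in> sigma_sets ?\<Omega> E" unfolding sS by simp
    qed
  qed fact
  have spP: "space P = ?\<Omega>" and spQ: "space Q = ?\<Omega>" using P Q by (auto dest: sets_eq_imp_space_eq)
  show ?thesis
  proof (rule measure_eqI_generator_eq[OF Int E_Pow])
    show "sets P = sigma_sets ?\<Omega> E" "sets Q = sigma_sets ?\<Omega> E" using P Q gen by auto
    show "emeasure P X = emeasure Q X" if "X \<in> E" for X
      using that eq unfolding E_def spP spQ by auto
    have "{\<omega> \<in> ?\<Omega>. \<forall>i\<in>{}. \<omega> i < (\<lambda>_. 0) i} \<in> E"
      unfolding E_def by (intro CollectI exI[of _ "{}"] exI[of _ "\<lambda>_. 0"]) simp
    then show "range (\<lambda>_::nat. ?\<Omega>) \<subseteq> E" by simp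
    show "(\<Union>i::nat. ?\<Omega>) = ?\<Omega>" by simp
    show "emeasure P ?\<Omega> \<noteq> \<infinity>" using finite_measure.emeasure_finite[OF fin] by simp
  qed
qed

text \<open>The left derivative at \<open>u = 1\<close> of \<open>u \<mapsto> \<integral> max y (u * p)\<close> is the integral of \<open>p\<close> over the set where
  \<open>y < p\<close>: there the maximum moves with slope \<open>p\<close>, elsewhere it does not move.\<close>

lemma strict_part_as_limit:
  fixes y p :: "'a \<Rightarrow> real"
  assumes y: "integrable M y" and p: "integrable M p"
    and nonneg: "\<And>x. x \<in> space M \<Longrightarrow> 0 \<le> p x"
  shows "(\<lambda>n. real (n + 2) * ((\<integral>x. max (y x) (p x) \<partial>M)
            - (\<integral>x. max (y x) ((1 - 1 / real (n + 2)) * p x) \<partial>M)))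
         \<longlonglongrightarrow> (\<integral>x. (if y x < p x then p x else 0) \<partial>M)"
proof -
  define q where "q n = 1 - 1 / real (n + 2)" for n
  have q: "0 \<le> q n" "q n \<le> 1" "real (n + 2) * (1 - q n) = 1" for n
    by (simp_all add: q_def)
  define s where "s n x = real (n + 2) * (max (y x) (p x) - max (y x) (q n * p x))" for n x
  have int: "integrable M (\<lambda>x. max (y x) (q n * p x))" for n
    using y p by (intro integrable_max integrable_mult_right)
  have int1: "integrable M (\<lambda>x. max (y x) (p x))" using y p by (rule integrable_max)
  have "(\<integral>x. s n x \<partial>M) = real (n + 2) * ((\<integral>x. max (y x) (p x) \<partial>M)
            - (\<integral>x. max (y x) (q n * p x) \<partial>M))" for n
    unfolding s_def using int int1 by simp
  moreover have "(\<lambda>n. \<integral>x. s n x \<partial>M) \<longlonglongrightarrow> (\<integral>x. (if y x < p x then p x else 0) \<partial>M)"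
  proof (rule integral_dominated_convergence[OF _ _ p])
    show "(\<lambda>x. if y x < p x then p x else 0) \<in> borel_measurable M" "s n \<in> borel_measurable M" for n
      using y p unfolding s_def by (auto dest!: borel_measurable_integrable)
    show "AE x in M. norm (s n x) \<le> p x" for n
    proof (rule AE_I2)
      fix x assume "x \<in> space M"
      then have p0: "0 \<le> p x" by (rule nonneg)
      have le: "q n * p x \<le> p x" using q[of n] p0 by (simp add: mult_left_le_one_le)
      then have 0: "0 \<le> max (y x) (p x) - max (y x) (q n * p x)" by simp
      have "max (y x) (p x) - max (y x) (q n * p x) \<le> (1 - q n) * p x"
        using le by (simp add: max_def algebra_simps)
      then have "s n x \<le> real (n + 2) * ((1 - q n) * p x)"
        unfolding s_def by (intro mult_left_mono) auto
      also have "\<dots> = p x" using q(3)[of n] by (metis mult.assoc mult_1)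
      finally show "norm (s n x) \<le> p x" using 0 by (simp add: s_def)
    qed
    show "AE x in M. (\<lambda>n. s n x) \<longlonglongrightarrow> (if y x < p x then p x else 0)"
    proof (rule AE_I2)
      fix x assume "x \<in> space M"
      then have p0: "0 \<le> p x" by (rule nonneg)
      show "(\<lambda>n. s n x) \<longlonglongrightarrow> (if y x < p x then p x else 0)"
      proof (cases "y x < p x")
        case True
        have "(\<lambda>n. q n * p x) \<longlonglongrightarrow> (1 - 0) * p x"
          unfolding q_def
          by (intro tendsto_mult tendsto_diff tendsto_const LIMSEQ_ignore_initial_segment[OF lim_1_over_n])
        then have "eventually (\<lambda>n. y x < q n * p x) sequentially"
          using True by (auto dest: order_tendstoD(1))
        then have "eventually (\<lambda>n. s n x = p x) sequentially"
        proof eventually_elim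
          case (elim n)
          then have "s n x = real (n + 2) * (1 - q n) * p x"
            using True by (simp add: s_def max_def algebra_simps)
          then show ?case unfolding q(3) by simp
        qed
        then show ?thesis using True by (simp add: tendsto_eventually)
      next
        case False
        have "s n x = 0" for n
        proof -
          have "q n * p x \<le> p x" using q[of n] p0 by (simp add: mult_left_le_one_le)
          then show ?thesis using False by (simp add: s_def max_def)
        qed
        then show ?thesis using False by simp
      qed
    qed
  qed
  ultimately show ?thesis unfolding q_def by simp
qed

section \<open>The law of the ratios\<close>

text \<open>Coefficients are strictly positive so that a max-span, which need not contain the zero function, is an
  instance.\<close>

definition max_cone :: "('a \<Rightarrow> real) set \<Rightarrow> bool" where
  "max_cone D \<longleftrightarrow> (\<forall>F\<in>D. \<forall>G\<in>D. \<forall>a>0. \<forall>b>0. (\<lambda>x. max (a * F x) (b * G x)) \<in> D)"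

lemma max_coneD:
  "max_cone D \<Longrightarrow> F \<in> D \<Longrightarrow> G \<in> D \<Longrightarrow> 0 < a \<Longrightarrow> 0 < b \<Longrightarrow> (\<lambda>x. max (a * F x) (b * G x)) \<in> D"
  unfolding max_cone_def by blast

lemma LplusD:
  assumes "F \<in> Lplus M \<alpha>"
  shows "F \<in> borel_measurable M" "\<And>x. x \<in> space M \<Longrightarrow> 0 \<le> F x" "integrable M (\<lambda>x. F x powr \<alpha>)"
  using assms unfolding Lplus_def by auto

lemma max_linear_isometryD:
  assumes "max_linear_isometry L D M D' \<alpha> W"
  shows "\<And>F. F \<in> D \<Longrightarrow> W F \<in> D'"
    "\<And>F G a b. F \<in> D \<Longrightarrow> G \<in> D \<Longrightarrow> 0 \<le> a \<Longrightarrow> 0 \<le> b \<Longrightarrow>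
      AE s in M. W (\<lambda>x. max (a * F x) (b * G x)) s = max (a * W F s) (b * W G s)"
    "\<And>F. F \<in> D \<Longrightarrow> (\<integral>s. W F s powr \<alpha> \<partial>M) = (\<integral>x. F x powr \<alpha> \<partial>L)"
  using assms unfolding max_linear_isometry_def by auto

lemma max_powr:
  fixes a b :: real
  assumes "0 \<le> a" "0 \<le> b" "0 < \<alpha>"
  shows "max a b powr \<alpha> = max (a powr \<alpha>) (b powr \<alpha>)"
  using assms by (auto simp: max_def powr_mono2 dest: powr_mono2[of \<alpha> b a] intro!: antisym)

lemma powr_less_iff_less:
  fixes a b :: real
  assumes "0 \<le> a" "0 \<le> b" "0 < \<alpha>"
  shows "a powr \<alpha> < b powr \<alpha> \<longleftrightarrow> a < b"
  using assms by (metis linorder_not_le powr_less_mono2 powr_mono2 less_imp_le)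

text \<open>The distinguished entry \<open>f0\<close> keeps the maximum meaningful for empty \<open>J\<close>.\<close>

lemma max_isometry_finite_Max:
  assumes iso: "max_linear_isometry L D M D' \<alpha> W" and cone: "max_cone D"
    and f0: "f0 \<in> D" and "finite J" "J \<subseteq> D" and b: "0 < b" and "\<And>F. F \<in> J \<Longrightarrow> 0 < c F"
  shows "(\<lambda>x. Max (insert (b * f0 x) ((\<lambda>F. c F * F x) ` J))) \<in> D \<and>
    (AE s in M. W (\<lambda>x. Max (insert (b * f0 x) ((\<lambda>F. c F * F x) ` J))) s
       = Max (insert (b * W f0 s) ((\<lambda>F. c F * W F s) ` J)))"
  using assms(4,5,7)
proof (induction J rule: finite_induct)
  case empty
  have "(\<lambda>x. max (b * f0 x) (b * f0 x)) \<in> D" using max_coneD[OF cone f0 f0 b b] .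
  moreover have "AE s in M. W (\<lambda>x. max (b * f0 x) (b * f0 x)) s = max (b * W f0 s) (b * W f0 s)"
    using max_linear_isometryD(2)[OF iso f0 f0, of b b] b by simp
  ultimately show ?case by simp
next
  case (insert G J)
  define H where "H = (\<lambda>x. Max (insert (b * f0 x) ((\<lambda>F. c F * F x) ` J)))"
  have HD: "H \<in> D" and HW: "AE s in M. W H s = Max (insert (b * W f0 s) ((\<lambda>F. c F * W F s) ` J))"
    unfolding H_def using insert by auto
  have G: "G \<in> D" "0 < c G" using insert by auto
  have eq: "(\<lambda>x. Max (insert (b * f0 x) ((\<lambda>F. c F * F x) ` insert G J)))
      = (\<lambda>x. max (1 * H x) (c G * G x))"
    unfolding H_def using insert(1) by (auto simp: insert_commute[of "_ * f0 _"] max.commute)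
  have "(\<lambda>x. max (1 * H x) (c G * G x)) \<in> D"
    using max_coneD[OF cone HD G(1) _ G(2), of 1] by simp
  moreover have "AE s in M. W (\<lambda>x. max (1 * H x) (c G * G x)) s = max (1 * W H s) (c G * W G s)"
    using max_linear_isometryD(2)[OF iso HD G(1), of 1 "c G"] G(2) by simp
  then have "AE s in M. W (\<lambda>x. max (1 * H x) (c G * G x)) s
      = Max (insert (b * W f0 s) ((\<lambda>F. c F * W F s) ` insert G J))"
    using HW
  proof eventually_elim
    case (elim s)
    then show ?case
      using insert(1) by (simp add: insert_commute[of "_ * W f0 _"] max.commute)
  qed
  ultimately show ?case unfolding eq by blast
qed

text \<open>Both sides are the limits of the same difference quotients: replacing \<open>f0\<close> by \<open>u powr (1 / \<alpha>) * f0\<close>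
  multiplies its \<open>\<alpha>\<close>-th power by \<open>u\<close>, and the isometry preserves the integral of the power of the maximum with \<open>H\<close>.\<close>

lemma max_isometry_strict_part:
  assumes \<alpha>: "0 < \<alpha>" and iso: "max_linear_isometry L D M (Lplus M \<alpha>) \<alpha> W"
    and D: "D \<subseteq> Lplus L \<alpha>" and cone: "max_cone D" and H: "H \<in> D" and f0: "f0 \<in> D"
  shows "(\<integral>x. (if H x < f0 x then f0 x powr \<alpha> else 0) \<partial>L)
       = (\<integral>s. (if W H s < W f0 s then W f0 s powr \<alpha> else 0) \<partial>M)"
proof -
  have LH: "H \<in> Lplus L \<alpha>" "f0 \<in> Lplus L \<alpha>" using D H f0 by auto
  have MH: "W H \<in> Lplus M \<alpha>" "W f0 \<in> Lplus M \<alpha>" using max_linear_isometryD(1)[OF iso] H f0 by auto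
  have int_eq: "(\<integral>x. max (H x powr \<alpha>) (u * f0 x powr \<alpha>) \<partial>L)
      = (\<integral>s. max (W H s powr \<alpha>) (u * W f0 s powr \<alpha>) \<partial>M)" if u: "0 < u" for u
  proof -
    define b where "b = u powr (1 / \<alpha>)"
    have b: "0 < b" "b powr \<alpha> = u" using u \<alpha> by (auto simp: b_def powr_powr)
    define G where "G = (\<lambda>x. max (1 * H x) (b * f0 x))"
    have G: "G \<in> D" unfolding G_def using max_coneD[OF cone H f0 _ b(1), of 1] by simp
    have WG: "AE s in M. W G s = max (1 * W H s) (b * W f0 s)"
      unfolding G_def using max_linear_isometryD(2)[OF iso H f0, of 1 b] b by simp
    have "(\<integral>x. max (H x powr \<alpha>) (u * f0 x powr \<alpha>) \<partial>L) = (\<integral>x. G x powr \<alpha> \<partial>L)"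
      using b \<alpha> LplusD(2)[OF LH(1)] LplusD(2)[OF LH(2)]
      by (intro Bochner_Integration.integral_cong) (auto simp: G_def max_powr powr_mult)
    also have "\<dots> = (\<integral>s. W G s powr \<alpha> \<partial>M)" using max_linear_isometryD(3)[OF iso G] by simp
    also have "\<dots> = (\<integral>s. max (W H s powr \<alpha>) (u * W f0 s powr \<alpha>) \<partial>M)"
    proof (rule integral_cong_AE)
      show "(\<lambda>s. W G s powr \<alpha>) \<in> borel_measurable M"
        using LplusD(1)[OF max_linear_isometryD(1)[OF iso G]] by measurable
      show "(\<lambda>s. max (W H s powr \<alpha>) (u * W f0 s powr \<alpha>)) \<in> borel_measurable M"
        using LplusD(1)[OF MH(1)] LplusD(1)[OF MH(2)] by measurable
      show "AE s in M. W G s powr \<alpha> = max (W H s powr \<alpha>) (u * W f0 s powr \<alpha>)"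
        using WG AE_space
      proof eventually_elim
        case (elim s)
        then show ?case
          using b \<alpha> LplusD(2)[OF MH(1), of s] LplusD(2)[OF MH(2), of s]
          by (simp add: max_powr powr_mult)
      qed
    qed
    finally show ?thesis .
  qed
  have q: "0 < 1 - 1 / real (n + 2)" for n by simp
  have "(\<integral>x. (if H x powr \<alpha> < f0 x powr \<alpha> then f0 x powr \<alpha> else 0) \<partial>L)
      = (\<integral>s. (if W H s powr \<alpha> < W f0 s powr \<alpha> then W f0 s powr \<alpha> else 0) \<partial>M)"
  proof (rule LIMSEQ_unique)
    show "(\<lambda>n. real (n + 2) * ((\<integral>x. max (H x powr \<alpha>) (f0 x powr \<alpha>) \<partial>L)
            - (\<integral>x. max (H x powr \<alpha>) ((1 - 1 / real (n + 2)) * f0 x powr \<alpha>) \<partial>L)))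
      \<longlonglongrightarrow> (\<integral>x. (if H x powr \<alpha> < f0 x powr \<alpha> then f0 x powr \<alpha> else 0) \<partial>L)"
      by (rule strict_part_as_limit[OF LplusD(3)[OF LH(1)] LplusD(3)[OF LH(2)]]) simp
    show "(\<lambda>n. real (n + 2) * ((\<integral>x. max (H x powr \<alpha>) (f0 x powr \<alpha>) \<partial>L)
            - (\<integral>x. max (H x powr \<alpha>) ((1 - 1 / real (n + 2)) * f0 x powr \<alpha>) \<partial>L)))
      \<longlonglongrightarrow> (\<integral>s. (if W H s powr \<alpha> < W f0 s powr \<alpha> then W f0 s powr \<alpha> else 0) \<partial>M)"
      unfolding int_eq[OF q] int_eq[of 1, simplified]
      by (rule strict_part_as_limit[OF LplusD(3)[OF MH(1)] LplusD(3)[OF MH(2)]]) simp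
  qed
  moreover have "(\<integral>x. (if H x powr \<alpha> < f0 x powr \<alpha> then f0 x powr \<alpha> else 0) \<partial>L)
      = (\<integral>x. (if H x < f0 x then f0 x powr \<alpha> else 0) \<partial>L)"
    using \<alpha> LplusD(2)[OF LH(1)] LplusD(2)[OF LH(2)]
    by (intro Bochner_Integration.integral_cong) (auto simp: powr_less_iff_less)
  moreover have "(\<integral>s. (if W H s powr \<alpha> < W f0 s powr \<alpha> then W f0 s powr \<alpha> else 0) \<partial>M)
      = (\<integral>s. (if W H s < W f0 s then W f0 s powr \<alpha> else 0) \<partial>M)"
    using \<alpha> LplusD(2)[OF MH(1)] LplusD(2)[OF MH(2)]
    by (intro Bochner_Integration.integral_cong) (auto simp: powr_less_iff_less)
  ultimately show ?thesis by simp
qed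

abbreviation powr_density :: "'a measure \<Rightarrow> real \<Rightarrow> ('a \<Rightarrow> real) \<Rightarrow> 'a measure" where
  "powr_density M \<alpha> p \<equiv> density M (\<lambda>x. ennreal (p x powr \<alpha>))"

lemma finite_measure_powr_density:
  assumes "p \<in> Lplus M \<alpha>"
  shows "finite_measure (powr_density M \<alpha> p)"
proof (rule finite_measureI)
  have [measurable]: "p \<in> borel_measurable M" by (rule LplusD(1)[OF assms])
  have "emeasure (powr_density M \<alpha> p) (space M) = (\<integral>\<^sup>+x. ennreal (p x powr \<alpha>) \<partial>M)"
    by (subst emeasure_density) (auto intro!: nn_integral_cong)
  also have "\<dots> = ennreal (\<integral>x. p x powr \<alpha> \<partial>M)"
    using LplusD(3)[OF assms] by (intro nn_integral_eq_integral) auto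
  finally show "emeasure (powr_density M \<alpha> p) (space (powr_density M \<alpha> p)) \<noteq> \<infinity>" by simp
qed

lemma emeasure_powr_density_less:
  assumes "p \<in> Lplus M \<alpha>" "H \<in> borel_measurable M"
  shows "emeasure (powr_density M \<alpha> p) {x \<in> space M. H x < p x}
    = ennreal (\<integral>x. (if H x < p x then p x powr \<alpha> else 0) \<partial>M)"
proof -
  have [measurable]: "p \<in> borel_measurable M" "H \<in> borel_measurable M"
    using LplusD(1)[OF assms(1)] assms(2) by auto
  have int: "integrable M (\<lambda>x. if H x < p x then p x powr \<alpha> else 0)"
    by (rule Bochner_Integration.integrable_bound[OF LplusD(3)[OF assms(1)]]) auto
  have "emeasure (powr_density M \<alpha> p) {x \<in> space M. H x < p x}
      = (\<integral>\<^sup>+x. ennreal (p x powr \<alpha>) * indicator {x \<in> space M. H x < p x} x \<partial>M)"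
    by (rule emeasure_density) measurable
  also have "\<dots> = (\<integral>\<^sup>+x. ennreal (if H x < p x then p x powr \<alpha> else 0) \<partial>M)"
    by (rule nn_integral_cong) auto
  also have "\<dots> = ennreal (\<integral>x. (if H x < p x then p x powr \<alpha> else 0) \<partial>M)"
    using int by (rule nn_integral_eq_integral) auto
  finally show ?thesis .
qed

lemma emeasure_ratio_event:
  assumes p: "p \<in> Lplus M \<alpha>" and J: "finite J" "\<And>F. F \<in> J \<Longrightarrow> V F \<in> borel_measurable M"
    "\<And>F. F \<in> J \<Longrightarrow> 0 < z F" and H: "H \<in> borel_measurable M"
    and H_eq: "AE s in M. H s = Max (insert (1/2 * p s) ((\<lambda>F. (1 / z F) * V F s) ` J))"
  shows "emeasure (powr_density M \<alpha> p) {s \<in> space M. \<forall>F\<in>J. V F s / p s < z F}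
    = ennreal (\<integral>s. (if H s < p s then p s powr \<alpha> else 0) \<partial>M)"
proof -
  have p_meas [measurable]: "p \<in> borel_measurable M" by (rule LplusD(1)[OF p])
  \<comment> \<open>The entry \<open>p / 2\<close> only makes the maximum range over a nonempty set: it never violates
    \<open>H < p\<close>.\<close>
  have event: "Max (insert (1/2 * c) ((\<lambda>F. (1 / z F) * v F) ` J)) < c
      \<longleftrightarrow> (\<forall>F\<in>J. v F / c < z F)" if "0 < c" for c :: real and v
  proof -
    have "(1 / z F) * v F < c \<longleftrightarrow> v F / c < z F" if "F \<in> J" for F
      using J(3)[OF that] \<open>0 < c\<close> by (simp add: pos_divide_less_eq mult.commute)
    then show ?thesis using J(1) that by auto
  qed
  have "emeasure (powr_density M \<alpha> p) {s \<in> space M. \<forall>F\<in>J. V F s / p s < z F}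
      = emeasure (powr_density M \<alpha> p) {s \<in> space M. H s < p s}"
  proof (rule emeasure_eq_AE)
    have "AE s in M. 0 < ennreal (p s powr \<alpha>) \<longrightarrow>
      (s \<in> {s \<in> space M. \<forall>F\<in>J. V F s / p s < z F}) = (s \<in> {s \<in> space M. H s < p s})"
      using H_eq AE_space
    proof eventually_elim
      case (elim s)
      show ?case
      proof
        assume "0 < ennreal (p s powr \<alpha>)"
        then have "0 < p s" using LplusD(2)[OF p, of s] elim(2) by (cases "p s = 0") auto
        then show "(s \<in> {s \<in> space M. \<forall>F\<in>J. V F s / p s < z F}) = (s \<in> {s \<in> space M. H s < p s})"
          using event[of "p s" "\<lambda>F. V F s"] elim by simp
      qed
    qed
    then show "AE s in powr_density M \<alpha> p. (s \<in> {s \<in> space M. \<forall>F\<in>J. V F s / p s < z F})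
        = (s \<in> {s \<in> space M. H s < p s})"
      by (subst AE_density) auto
    have "{s \<in> space M. V F s / p s < z F} \<in> sets M" if "F \<in> J" for F
    proof -
      have [measurable]: "V F \<in> borel_measurable M" using J(2)[OF that] .
      show ?thesis by measurable
    qed
    then have "{s \<in> space M. \<forall>F\<in>J. V F s / p s < z F} \<in> sets M"
      by (intro sets.sets_Collect_finite_All J(1))
    then show "{s \<in> space M. \<forall>F\<in>J. V F s / p s < z F} \<in> sets (powr_density M \<alpha> p)" by simp
    show "{s \<in> space M. H s < p s} \<in> sets (powr_density M \<alpha> p)"
      using H by simp
  qed
  then show ?thesis using emeasure_powr_density_less[OF p H] by simp
qed

lemma measurable_ratios:
  assumes "\<And>F. F \<in> D \<Longrightarrow> V F \<in> borel_measurable M" "p \<in> borel_measurable M"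
  shows "(\<lambda>s. \<lambda>F\<in>D. V F s / p s) \<in> measurable M (Pi\<^sub>M D (\<lambda>_. borel :: real measure))"
  by (rule measurable_restrict) (use assms in measurable)

text \<open>The event that \<open>F / f0 < z F\<close> for all \<open>F\<close> in a finite set is the event \<open>H < f0\<close> for the weighted
  maximum \<open>H\<close> of these \<open>F\<close> with weights \<open>1 / z F\<close>, and the isometry carries \<open>H\<close> to the corresponding maximum
  of the \<open>W F\<close>.\<close>

lemma max_isometry_ratio_law:
  assumes \<alpha>: "0 < \<alpha>" and iso: "max_linear_isometry L D M (Lplus M \<alpha>) \<alpha> W"
    and D: "D \<subseteq> Lplus L \<alpha>" and cone: "max_cone D" and f0: "f0 \<in> D"
  shows "distr (powr_density L \<alpha> f0) (Pi\<^sub>M D (\<lambda>_. borel)) (\<lambda>x. \<lambda>F\<in>D. F x / f0 x)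
       = distr (powr_density M \<alpha> (W f0)) (Pi\<^sub>M D (\<lambda>_. borel)) (\<lambda>s. \<lambda>F\<in>D. W F s / W f0 s)"
    (is "?P = ?Q")
proof (rule measure_eqI_PiM_real)
  have Lf0: "f0 \<in> Lplus L \<alpha>" using D f0 by auto
  have WL: "\<And>F. F \<in> D \<Longrightarrow> W F \<in> Lplus M \<alpha>" using max_linear_isometryD(1)[OF iso] .
  have L1: "F \<in> borel_measurable L" if "F \<in> D" for F
    using that D by (auto intro: LplusD(1))
  have R: "(\<lambda>x. \<lambda>F\<in>D. F x / f0 x) \<in> measurable (powr_density L \<alpha> f0) (Pi\<^sub>M D (\<lambda>_. borel))"
    using measurable_ratios[OF L1 L1[OF f0]] by simp
  have R': "(\<lambda>s. \<lambda>F\<in>D. W F s / W f0 s) \<in> measurable (powr_density M \<alpha> (W f0)) (Pi\<^sub>M D (\<lambda>_. borel))"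
    using measurable_ratios[of D W, OF LplusD(1)[OF WL] LplusD(1)[OF WL[OF f0]]] by simp
  show "finite_measure ?P"
    by (rule finite_measure.finite_measure_distr[OF finite_measure_powr_density[OF Lf0] R])
  fix J :: "('a \<Rightarrow> real) set" and z :: "('a \<Rightarrow> real) \<Rightarrow> real"
  assume J: "finite J" "J \<subseteq> D"
  let ?B = "{\<omega> \<in> space (Pi\<^sub>M D (\<lambda>_. borel :: real measure)). \<forall>F\<in>J. \<omega> F < z F}"
  have B: "?B \<in> sets (Pi\<^sub>M D (\<lambda>_. borel))"
  proof (intro sets.sets_Collect_finite_All J(1))
    fix F assume "F \<in> J"
    then have "(\<lambda>\<omega>. \<omega> F) \<in> borel_measurable (Pi\<^sub>M D (\<lambda>_. borel :: real measure))"
      using J(2) by (auto intro: measurable_component_singleton)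
    then show "{\<omega> \<in> space (Pi\<^sub>M D (\<lambda>_. borel)). \<omega> F < z F} \<in> sets (Pi\<^sub>M D (\<lambda>_. borel :: real measure))"
      by (simp add: borel_measurable_iff_less)
  qed
  have P: "emeasure ?P ?B = emeasure (powr_density L \<alpha> f0) {x \<in> space L. \<forall>F\<in>J. F x / f0 x < z F}"
    unfolding emeasure_distr[OF R B] using J(2)
    by (intro arg_cong2[of _ _ _ _ emeasure] refl) (auto simp: space_PiM PiE_def)
  have Q: "emeasure ?Q ?B
      = emeasure (powr_density M \<alpha> (W f0)) {s \<in> space M. \<forall>F\<in>J. W F s / W f0 s < z F}"
    unfolding emeasure_distr[OF R' B] using J(2)
    by (intro arg_cong2[of _ _ _ _ emeasure] refl) (auto simp: space_PiM PiE_def)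
  have "emeasure ?P ?B = emeasure ?Q ?B"
  proof (cases "\<forall>F\<in>J. 0 < z F")
    case False
    then obtain F where F: "F \<in> J" "z F \<le> 0" by (auto simp: not_less)
    have FD: "F \<in> D" "F \<in> Lplus L \<alpha>" using F J D by auto
    have "0 \<le> F x / f0 x" if "x \<in> space L" for x
      using that LplusD(2)[OF FD(2)] LplusD(2)[OF Lf0] by simp
    then have "{x \<in> space L. \<forall>F\<in>J. F x / f0 x < z F} = {}"
      using F by (fastforce simp: not_less)
    moreover have "0 \<le> W F s / W f0 s" if "s \<in> space M" for s
      using that LplusD(2)[OF WL[OF FD(1)]] LplusD(2)[OF WL[OF f0]] by simp
    then have "{s \<in> space M. \<forall>F\<in>J. W F s / W f0 s < z F} = {}"
      using F by (fastforce simp: not_less)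
    ultimately show ?thesis unfolding P Q by (simp only: emeasure_empty)
  next
    case True
    define H where "H = (\<lambda>x. Max (insert (1/2 * f0 x) ((\<lambda>F. (1 / z F) * F x) ` J)))"
    have H: "H \<in> D" and WH: "AE s in M. W H s
        = Max (insert (1/2 * W f0 s) ((\<lambda>F. (1 / z F) * W F s) ` J))"
      using max_isometry_finite_Max[OF iso cone f0 J(1) J(2), of "1/2" "\<lambda>F. 1 / z F"] True
      unfolding H_def by auto
    have JD: "F \<in> D" if "F \<in> J" for F using that J(2) by auto
    have LH: "H \<in> borel_measurable L" using H D by (auto dest: LplusD(1))
    have "emeasure ?P ?B = ennreal (\<integral>x. (if H x < f0 x then f0 x powr \<alpha> else 0) \<partial>L)"
      unfolding P
      by (rule emeasure_ratio_event[OF Lf0 J(1) _ _ LH])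
        (use True JD D in \<open>auto simp: H_def dest: LplusD(1)\<close>)
    also have "\<dots> = ennreal (\<integral>s. (if W H s < W f0 s then W f0 s powr \<alpha> else 0) \<partial>M)"
      by (subst max_isometry_strict_part[OF \<alpha> iso D cone H f0]) (rule refl)
    also have "\<dots> = emeasure ?Q ?B"
      unfolding Q
      by (rule emeasure_ratio_event[symmetric, OF WL[OF f0] J(1) _ _ LplusD(1)[OF WL[OF H]] WH])
        (use True JD WL in \<open>auto dest: LplusD(1)\<close>)
    finally show ?thesis .
  qed
  then show "emeasure ?P {\<omega> \<in> space ?P. \<forall>i\<in>J. \<omega> i < z i} = emeasure ?Q {\<omega> \<in> space ?Q. \<forall>i\<in>J. \<omega> i < z i}"
    by simp
qed simp_all

section \<open>Recovering points from ratios\<close>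

text \<open>Compare \<open>\<integral> max F (b * f0) ^ \<alpha> - \<integral> (b * f0) ^ \<alpha>\<close> on the two sides as \<open>b\<close> grows. On \<open>L\<close> it tends to 0
  because \<open>f0\<close> is positive; on \<open>M\<close> it is at least the integral of \<open>(W F) ^ \<alpha>\<close> over the zero set of \<open>W f0\<close>.\<close>

lemma max_isometry_vanishes:
  assumes \<alpha>: "0 < \<alpha>" and iso: "max_linear_isometry L D M (Lplus M \<alpha>) \<alpha> W"
    and D: "D \<subseteq> Lplus L \<alpha>" and cone: "max_cone D" and F: "F \<in> D" and f0: "f0 \<in> D"
    and full: "AE x in L. 0 < f0 x"
  shows "AE s in M. W f0 s = 0 \<longrightarrow> W F s = 0"
proof -
  have LF: "F \<in> Lplus L \<alpha>" "f0 \<in> Lplus L \<alpha>" using D F f0 by auto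
  have MF: "W F \<in> Lplus M \<alpha>" "W f0 \<in> Lplus M \<alpha>" using max_linear_isometryD(1)[OF iso] F f0 by auto
  note [measurable] = LplusD(1)[OF LF(1)] LplusD(1)[OF LF(2)] LplusD(1)[OF MF(1)] LplusD(1)[OF MF(2)]
  define b where "b n = real (Suc n)" for n
  have b: "0 < b n" for n by (simp add: b_def)
  define G where "G n = (\<lambda>x. max (1 * F x) (b n * f0 x))" for n
  define B where "B n = (\<lambda>x. b n * f0 x)" for n
  have G: "G n \<in> D" for n unfolding G_def using max_coneD[OF cone F f0 _ b, of 1] by simp
  have B: "B n \<in> D" for n
    unfolding B_def using max_coneD[OF cone f0 f0 b b, of n n] by simp
  have WG: "AE s in M. W (G n) s = max (W F s) (b n * W f0 s)" for n
    unfolding G_def using max_linear_isometryD(2)[OF iso F f0, of 1 "b n"] b[of n] by simp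
  have WB: "AE s in M. W (B n) s = b n * W f0 s" for n
    unfolding B_def using max_linear_isometryD(2)[OF iso f0 f0, of "b n" "b n"] b[of n] by simp
  define \<delta> where "\<delta> n x = G n x powr \<alpha> - B n x powr \<alpha>" for n x
  define \<delta>' where "\<delta>' n s = W (G n) s powr \<alpha> - W (B n) s powr \<alpha>" for n s
  have int: "integrable L (\<lambda>x. G n x powr \<alpha>)" "integrable L (\<lambda>x. B n x powr \<alpha>)"
    "integrable M (\<lambda>x. W (G n) x powr \<alpha>)" "integrable M (\<lambda>x. W (B n) x powr \<alpha>)" for n
    using G[of n] B[of n] D max_linear_isometryD(1)[OF iso] by (blast dest: LplusD(3))+
  have eq: "(\<integral>x. \<delta> n x \<partial>L) = (\<integral>s. \<delta>' n s \<partial>M)" for n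
    unfolding \<delta>_def \<delta>'_def
    using int[of n] max_linear_isometryD(3)[OF iso G, of n] max_linear_isometryD(3)[OF iso B, of n]
    by simp
  have lim: "(\<lambda>n. \<integral>x. \<delta> n x \<partial>L) \<longlonglongrightarrow> (\<integral>x. 0 \<partial>L)"
  proof (rule integral_dominated_convergence[OF _ _ LplusD(3)[OF LF(1)]])
    show "\<delta> n \<in> borel_measurable L" for n unfolding \<delta>_def G_def B_def by measurable
    show "AE x in L. norm (\<delta> n x) \<le> F x powr \<alpha>" for n
    proof (rule AE_I2)
      fix x assume "x \<in> space L"
      then have "0 \<le> F x" "0 \<le> b n * f0 x" using LplusD(2)[OF LF(1)] LplusD(2)[OF LF(2)] b[of n] by auto
      then show "norm (\<delta> n x) \<le> F x powr \<alpha>"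
        using \<alpha> by (simp add: \<delta>_def G_def B_def max_powr) (simp add: max_def)
    qed
    show "AE x in L. (\<lambda>n. \<delta> n x) \<longlonglongrightarrow> 0"
      using full
    proof eventually_elim
      case (elim x)
      obtain N :: nat where N: "F x < real N * f0 x" using ex_less_of_nat_mult[OF elim] by auto
      have "eventually (\<lambda>n. \<delta> n x = 0) sequentially"
        unfolding eventually_sequentially
      proof (intro exI allI impI)
        fix n assume "N \<le> n"
        then have "real N * f0 x \<le> b n * f0 x" using elim by (intro mult_right_mono) (auto simp: b_def)
        then show "\<delta> n x = 0" using N by (simp add: \<delta>_def G_def B_def max_def)
      qed
      then show ?case by (rule tendsto_eventually)
    qed
  qed simp
  define Z where "Z = {s \<in> space M. W f0 s = 0}"
  have Z [measurable]: "Z \<in> sets M" unfolding Z_def by measurable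
  have intZ: "integrable M (\<lambda>s. indicator Z s * W F s powr \<alpha>)"
    using integrable_real_mult_indicator[OF Z LplusD(3)[OF MF(1)]] by (simp add: mult.commute)
  have "(\<integral>s. indicator Z s * W F s powr \<alpha> \<partial>M) \<le> (\<integral>s. \<delta>' n s \<partial>M)" for n
  proof (rule integral_mono_AE[OF intZ])
    show "integrable M (\<delta>' n)" unfolding \<delta>'_def using int by simp
    show "AE s in M. indicator Z s * W F s powr \<alpha> \<le> \<delta>' n s"
      using WG[of n] WB[of n] AE_space
    proof eventually_elim
      case (elim s)
      then have nn: "0 \<le> W F s" "0 \<le> b n * W f0 s"
        using LplusD(2)[OF MF(1)] LplusD(2)[OF MF(2)] b[of n] by auto
      show ?case
        using nn elim \<alpha> by (auto simp: \<delta>'_def Z_def max_powr indicator_def)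
    qed
  qed
  then have "(\<integral>s. indicator Z s * W F s powr \<alpha> \<partial>M) \<le> (\<integral>x. \<delta> n x \<partial>L)" for n
    using eq by simp
  then have "(\<integral>s. indicator Z s * W F s powr \<alpha> \<partial>M) \<le> 0"
    using LIMSEQ_le_const[OF lim] by auto
  moreover have "0 \<le> (\<integral>s. indicator Z s * W F s powr \<alpha> \<partial>M)" by (rule integral_nonneg_AE) auto
  ultimately have "(\<integral>s. indicator Z s * W F s powr \<alpha> \<partial>M) = 0" by simp
  then have "AE s in M. indicator Z s * W F s powr \<alpha> = 0"
    by (subst (asm) integral_nonneg_eq_0_iff_AE[OF intZ]) auto
  with AE_space show ?thesis by eventually_elim (auto simp: Z_def)
qed

text \<open>The factor \<open>f0\<close> cancels in a ratio \<open>f t / f t'\<close>, so the ratios of the family are functions of the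
  normalised coordinates wherever \<open>f0\<close> is positive.\<close>

lemma ratio_sigma_vimage:
  fixes L :: "'a measure" and f :: "'t \<Rightarrow> 'a \<Rightarrow> real"
  assumes f: "\<And>t. t \<in> T \<Longrightarrow> f t \<in> D" and nonneg: "\<And>t x. t \<in> T \<Longrightarrow> x \<in> space L \<Longrightarrow> 0 \<le> f t x"
    and A: "A \<in> ratio_sigma L f T"
  shows "\<exists>C\<in>sets (Pi\<^sub>M D (\<lambda>_. borel :: real measure)).
    \<forall>x\<in>space L. 0 < f0 x \<longrightarrow> (x \<in> A \<longleftrightarrow> (\<lambda>F\<in>D. F x / f0 x) \<in> C)"
  using A unfolding ratio_sigma_def
proof (induction A rule: sigma_sets.induct)
  case (Basic a)
  then obtain t t' B where a: "a = (\<lambda>s. ennreal (f t s) / ennreal (f t' s)) -` B \<inter> space L"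
    and t: "t \<in> T" "t' \<in> T" and B: "B \<in> sets borel"
    by auto
  let ?P = "Pi\<^sub>M D (\<lambda>_. borel :: real measure)"
  have [measurable]: "(\<lambda>\<omega>. \<omega> (f t)) \<in> borel_measurable ?P" "(\<lambda>\<omega>. \<omega> (f t')) \<in> borel_measurable ?P"
    using t f by (auto intro: measurable_component_singleton)
  have m: "(\<lambda>\<omega>. ennreal (\<omega> (f t)) / ennreal (\<omega> (f t'))) \<in> borel_measurable ?P" by measurable
  define C where "C = (\<lambda>\<omega>. ennreal (\<omega> (f t)) / ennreal (\<omega> (f t'))) -` B \<inter> space ?P"
  have "C \<in> sets ?P" unfolding C_def using m B by (rule measurable_sets)
  moreover have "x \<in> a \<longleftrightarrow> (\<lambda>F\<in>D. F x / f0 x) \<in> C" if x: "x \<in> space L" "0 < f0 x" for x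
  proof -
    have "ennreal (f t x / f0 x) / ennreal (f t' x / f0 x) = ennreal (f t x) / ennreal (f t' x)"
    proof (cases "f t' x = 0")
      case True
      then show ?thesis
        using nonneg[OF t(1) x(1)] x(2) by (cases "f t x = 0") (auto simp: ennreal_divide_zero)
    next
      case False
      then have "0 < f t' x" using nonneg[OF t(2) x(1)] by simp
      then show ?thesis using nonneg[OF t(1) x(1)] x(2) by (simp add: divide_ennreal)
    qed
    then show ?thesis
      using x f[OF t(1)] f[OF t(2)] by (simp add: a C_def space_PiM)
  qed
  ultimately show ?case by blast
next
  case Empty
  show ?case by (rule bexI[of _ "{}"]) auto
next
  case (Compl a)
  then obtain C where C: "C \<in> sets (Pi\<^sub>M D (\<lambda>_. borel :: real measure))"
    "\<forall>x\<in>space L. 0 < f0 x \<longrightarrow> (x \<in> a \<longleftrightarrow> (\<lambda>F\<in>D. F x / f0 x) \<in> C)" by blast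
  have "(\<lambda>F\<in>D. F x / f0 x) \<in> space (Pi\<^sub>M D (\<lambda>_. borel :: real measure))" for x
    by (simp add: space_PiM)
  then show ?case
    using C by (intro bexI[of _ "space (Pi\<^sub>M D (\<lambda>_. borel)) - C"] ballI impI) (blast, simp)
next
  case (Union a)
  then have "\<forall>i. \<exists>C\<in>sets (Pi\<^sub>M D (\<lambda>_. borel :: real measure)).
    \<forall>x\<in>space L. 0 < f0 x \<longrightarrow> (x \<in> a i \<longleftrightarrow> (\<lambda>F\<in>D. F x / f0 x) \<in> C)" by blast
  then obtain C where C: "\<And>i::nat. C i \<in> sets (Pi\<^sub>M D (\<lambda>_. borel :: real measure))"
    "\<And>i x. x\<in>space L \<Longrightarrow> 0 < f0 x \<Longrightarrow> (x \<in> a i \<longleftrightarrow> (\<lambda>F\<in>D. F x / f0 x) \<in> C i)" by metis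
  show ?case
  proof (rule bexI[of _ "\<Union>i. C i"], intro ballI impI)
    fix x assume "x \<in> space L" "0 < f0 x"
    then show "x \<in> (\<Union>i. a i) \<longleftrightarrow> (\<lambda>F\<in>D. F x / f0 x) \<in> (\<Union>i. C i)" using C(2) by blast
  qed (use C(1) in blast)
qed

text \<open>Up to null sets, each half-line \<open>x \<le> q\<close> with rational \<open>q\<close> is the event that the ratios lie in some
  product-measurable set \<open>C q\<close>. The point is then the infimum of those \<open>q\<close> for which this happens.\<close>

lemma minimal_family_reconstruction:
  fixes f :: "'t \<Rightarrow> real \<Rightarrow> real"
  assumes minimal: "\<And>B. B \<in> sets (lambda_IN I N) \<Longrightarrow>
      \<exists>A\<in>ratio_sigma (lambda_IN I N) f T. emeasure (lambda_IN I N) ((A - B) \<union> (B - A)) = 0"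
    and f: "\<And>t. t \<in> T \<Longrightarrow> f t \<in> D" and meas: "\<And>t. t \<in> T \<Longrightarrow> f t \<in> borel_measurable (lambda_IN I N)"
    and nonneg: "\<And>t x. t \<in> T \<Longrightarrow> x \<in> S_IN I N \<Longrightarrow> 0 \<le> f t x"
    and ne: "S_IN I N \<noteq> {}"
  obtains \<psi> where "\<psi> \<in> measurable (Pi\<^sub>M D (\<lambda>_. borel :: real measure)) (lambda_IN I N)"
    "AE x in lambda_IN I N. 0 < f0 x \<longrightarrow> \<psi> (\<lambda>F\<in>D. F x / f0 x) = x"
proof -
  let ?L = "lambda_IN I N" and ?P = "Pi\<^sub>M D (\<lambda>_. borel :: real measure)"
  obtain x0 where x0: "x0 \<in> S_IN I N" using ne by auto
  have ratio_sets: "ratio_sigma ?L f T \<subseteq> sets ?L"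
    unfolding ratio_sigma_def
  proof (rule sets.sigma_sets_subset, safe)
    fix t t' and B :: "ennreal set" assume "t \<in> T" "t' \<in> T" and B: "B \<in> sets borel"
    then have [measurable]: "f t \<in> borel_measurable ?L" "f t' \<in> borel_measurable ?L" using meas by auto
    have m: "(\<lambda>s. ennreal (f t s) / ennreal (f t' s)) \<in> borel_measurable ?L" by measurable
    show "(\<lambda>s. ennreal (f t s) / ennreal (f t' s)) -` B \<inter> space ?L \<in> sets ?L"
      by (rule measurable_sets[OF m B])
  qed
  have "\<exists>C\<in>sets ?P. AE x in ?L. 0 < f0 x \<longrightarrow> (x \<le> real_of_rat q \<longleftrightarrow> (\<lambda>F\<in>D. F x / f0 x) \<in> C)" for q
  proof -
    have B: "S_IN I N \<inter> {..real_of_rat q} \<in> sets ?L"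
      using S_IN_borel[of I N] by (auto simp: sets_lambda_IN_iff)
    obtain A where A: "A \<in> ratio_sigma ?L f T"
      "emeasure ?L ((A - S_IN I N \<inter> {..real_of_rat q}) \<union> (S_IN I N \<inter> {..real_of_rat q} - A)) = 0"
      using minimal[OF B] by blast
    have "(A - S_IN I N \<inter> {..real_of_rat q}) \<union> (S_IN I N \<inter> {..real_of_rat q} - A) \<in> sets ?L"
      using A(1) ratio_sets B by (intro sets.Un sets.Diff) auto
    then have ae: "AE x in ?L. x \<notin> (A - S_IN I N \<inter> {..real_of_rat q}) \<union> (S_IN I N \<inter> {..real_of_rat q} - A)"
      using A(2) by (intro AE_not_in) (auto simp: null_sets_def)
    have "\<exists>C\<in>sets ?P. \<forall>x\<in>space ?L. 0 < f0 x \<longrightarrow> (x \<in> A \<longleftrightarrow> (\<lambda>F\<in>D. F x / f0 x) \<in> C)"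
      by (rule ratio_sigma_vimage[OF f _ A(1)]) (simp_all add: nonneg)
    then obtain C where C: "C \<in> sets ?P"
      "\<And>x. x \<in> space ?L \<Longrightarrow> 0 < f0 x \<Longrightarrow> x \<in> A \<longleftrightarrow> (\<lambda>F\<in>D. F x / f0 x) \<in> C"
      by blast
    have "AE x in ?L. 0 < f0 x \<longrightarrow> (x \<le> real_of_rat q \<longleftrightarrow> (\<lambda>F\<in>D. F x / f0 x) \<in> C)"
      using ae AE_space
    proof eventually_elim
      case (elim x)
      then have "x \<in> A \<longleftrightarrow> x \<le> real_of_rat q" by auto
      then show ?case using C(2)[OF elim(2)] by simp
    qed
    with C(1) show ?thesis by blast
  qed
  then have "\<forall>q. \<exists>C. C \<in> sets ?P \<and>
      (AE x in ?L. 0 < f0 x \<longrightarrow> (x \<le> real_of_rat q \<longleftrightarrow> (\<lambda>F\<in>D. F x / f0 x) \<in> C))"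
    by blast
  from choice[OF this] obtain C where C: "\<And>q. C q \<in> sets ?P"
    and C_AE: "\<And>q. AE x in ?L. 0 < f0 x \<longrightarrow> (x \<le> real_of_rat q \<longleftrightarrow> (\<lambda>F\<in>D. F x / f0 x) \<in> C q)"
    by blast
  define v where "v \<omega> = (INF q. if \<omega> \<in> C q then ereal (real_of_rat q) else \<infinity>)" for \<omega>
  define \<psi> where "\<psi> \<omega> = (if real_of_ereal (v \<omega>) \<in> S_IN I N then real_of_ereal (v \<omega>) else x0)" for \<omega>
  have v_meas [measurable]: "v \<in> borel_measurable ?P"
    unfolding v_def using C by (intro borel_measurable_INF measurable_If) auto
  have "\<psi> \<in> borel_measurable ?P"
    unfolding \<psi>_def using S_IN_borel[of I N] by measurable
  then have \<psi>_meas: "\<psi> \<in> measurable ?P ?L"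
    unfolding measurable_lambda_IN_iff using x0 by (auto simp: \<psi>_def)
  have "AE x in ?L. \<forall>q. 0 < f0 x \<longrightarrow> (x \<le> real_of_rat q \<longleftrightarrow> (\<lambda>F\<in>D. F x / f0 x) \<in> C q)"
    unfolding AE_all_countable using C_AE by blast
  then have "AE x in ?L. 0 < f0 x \<longrightarrow> \<psi> (\<lambda>F\<in>D. F x / f0 x) = x"
    using AE_space
  proof eventually_elim
    case (elim x)
    show ?case
    proof
      assume pos: "0 < f0 x"
      have "v (\<lambda>F\<in>D. F x / f0 x) = ereal x"
        unfolding v_def
      proof (rule INF_eqI)
        fix q show "ereal x \<le> (if (\<lambda>F\<in>D. F x / f0 x) \<in> C q then ereal (real_of_rat q) else \<infinity>)"
          using elim(1) pos by auto
      next
        fix y :: ereal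
        assume y: "\<And>q. q \<in> UNIV \<Longrightarrow> y \<le> (if (\<lambda>F\<in>D. F x / f0 x) \<in> C q then ereal (real_of_rat q) else \<infinity>)"
        show "y \<le> ereal x"
        proof (rule ereal_le_epsilon2)
          fix e :: real assume "0 < e"
          then obtain q where q: "x < real_of_rat q" "real_of_rat q < x + e"
            using of_rat_dense[of x "x + e"] by auto
          then have "(\<lambda>F\<in>D. F x / f0 x) \<in> C q" using elim(1) pos by (metis less_imp_le)
          then have "y \<le> ereal (real_of_rat q)" using y[of q] by (simp only: if_True UNIV_I)
          then show "y \<le> ereal x + ereal e" using q(2) by (auto intro: order_trans)
        qed
      qed
      then show "\<psi> (\<lambda>F\<in>D. F x / f0 x) = x" using elim(2) by (simp add: \<psi>_def)
    qed
  qed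
  with \<psi>_meas show thesis by (rule that)
qed

section \<open>Point form of a max-linear isometry\<close>

lemma max_linear_isometry_subset:
  "max_linear_isometry L D M D' \<alpha> W \<Longrightarrow> D0 \<subseteq> D \<Longrightarrow> max_linear_isometry L D0 M D' \<alpha> W"
  unfolding max_linear_isometry_def by (meson subsetD)

lemma measurable_reconstruction:
  assumes iso: "max_linear_isometry L D M (Lplus M \<alpha>) \<alpha> W" and f0: "f0 \<in> D"
    and \<psi>: "\<psi> \<in> measurable (Pi\<^sub>M D (\<lambda>_. borel)) L"
  shows "(\<lambda>s. \<psi> (\<lambda>F\<in>D. W F s / W f0 s)) \<in> measurable M L"
proof -
  have "W F \<in> borel_measurable M" if "F \<in> D" for F
    using that max_linear_isometryD(1)[OF iso] by (blast dest: LplusD(1))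
  then have "(\<lambda>s. \<lambda>F\<in>D. W F s / W f0 s) \<in> measurable M (Pi\<^sub>M D (\<lambda>_. borel :: real measure))"
    using f0 by (intro measurable_ratios) auto
  then show ?thesis using \<psi> by (rule measurable_compose)
qed

text \<open>On \<open>L\<close> the coordinate \<open>F / f0\<close> equals \<open>(F / f0) \<circ> \<psi>\<close> of the coordinates in \<open>D0\<close>. This is an almost sure
  property of the law of all ratios, so it also holds for the ratios of the images under \<open>W\<close>. The point map
  involves only \<open>D0\<close>, whereas \<open>F\<close> ranges over the larger set \<open>D\<close>: this separation is what makes
  extensions of an isometry unique.\<close>

lemma max_isometry_point_form:
  assumes \<alpha>: "0 < \<alpha>" and iso: "max_linear_isometry L D M (Lplus M \<alpha>) \<alpha> W"
    and D: "D \<subseteq> Lplus L \<alpha>" and cone: "max_cone D" and D0: "D0 \<subseteq> D" and f0: "f0 \<in> D0"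
    and full: "AE x in L. 0 < f0 x"
    and \<psi>: "\<psi> \<in> measurable (Pi\<^sub>M D0 (\<lambda>_. borel)) L"
    and rec: "AE x in L. 0 < f0 x \<longrightarrow> \<psi> (\<lambda>F\<in>D0. F x / f0 x) = x"
    and \<Phi>: "\<And>s. \<Phi> s = \<psi> (\<lambda>F\<in>D0. W F s / W f0 s)" and F: "F \<in> D"
  shows "AE s in M. W F s = (W f0 s / f0 (\<Phi> s)) * F (\<Phi> s)"
proof -
  let ?P = "Pi\<^sub>M D (\<lambda>_. borel :: real measure)"
  have f0D: "f0 \<in> D" using D0 f0 by auto
  have WL: "\<And>F. F \<in> D \<Longrightarrow> W F \<in> Lplus M \<alpha>" using max_linear_isometryD(1)[OF iso] .
  have L1: "F \<in> borel_measurable L" if "F \<in> D" for F using that D by (auto intro: LplusD(1))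
  have R: "(\<lambda>x. \<lambda>F\<in>D. F x / f0 x) \<in> measurable (powr_density L \<alpha> f0) ?P"
    using measurable_ratios[OF L1 L1[OF f0D]] by simp
  have R': "(\<lambda>s. \<lambda>F\<in>D. W F s / W f0 s) \<in> measurable (powr_density M \<alpha> (W f0)) ?P"
    using measurable_ratios[of D W, OF LplusD(1)[OF WL] LplusD(1)[OF WL[OF f0D]]] by simp
  define point where "point \<omega> = \<psi> (restrict \<omega> D0)" for \<omega>
  have point: "point \<in> measurable ?P L"
    unfolding point_def using measurable_restrict_subset[OF D0] \<psi> by (rule measurable_compose)
  have FD: "F \<in> borel_measurable L" "f0 \<in> borel_measurable L" using L1 F f0D by auto
  have [measurable]: "(\<lambda>\<omega>. \<omega> F) \<in> borel_measurable ?P" using F by (rule measurable_component_singleton)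
  have [measurable]: "(\<lambda>\<omega>. F (point \<omega>)) \<in> borel_measurable ?P" "(\<lambda>\<omega>. f0 (point \<omega>)) \<in> borel_measurable ?P"
    using measurable_compose[OF point FD(1)] measurable_compose[OF point FD(2)] by auto
  have B: "{\<omega> \<in> space ?P. \<omega> F = F (point \<omega>) / f0 (point \<omega>)} \<in> sets ?P" by measurable
  have fm: "(\<lambda>x. ennreal (f0 x powr \<alpha>)) \<in> borel_measurable L"
    "(\<lambda>s. ennreal (W f0 s powr \<alpha>)) \<in> borel_measurable M"
    using FD(2) LplusD(1)[OF WL[OF f0D]] by measurable
  have "AE x in powr_density L \<alpha> f0. (\<lambda>F\<in>D. F x / f0 x) F
      = F (point (\<lambda>F\<in>D. F x / f0 x)) / f0 (point (\<lambda>F\<in>D. F x / f0 x))"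
    unfolding AE_density[OF fm(1)] using rec full
    by eventually_elim (use F in \<open>auto simp: point_def Int_absorb1[OF D0]\<close>)
  then have "AE \<omega> in distr (powr_density L \<alpha> f0) ?P (\<lambda>x. \<lambda>F\<in>D. F x / f0 x).
      \<omega> F = F (point \<omega>) / f0 (point \<omega>)"
    by (subst AE_distr_iff[OF R B])
  then have "AE \<omega> in distr (powr_density M \<alpha> (W f0)) ?P (\<lambda>s. \<lambda>F\<in>D. W F s / W f0 s).
      \<omega> F = F (point \<omega>) / f0 (point \<omega>)"
    unfolding max_isometry_ratio_law[OF \<alpha> iso D cone f0D] .
  then have "AE s in powr_density M \<alpha> (W f0). (\<lambda>F\<in>D. W F s / W f0 s) F
      = F (point (\<lambda>F\<in>D. W F s / W f0 s)) / f0 (point (\<lambda>F\<in>D. W F s / W f0 s))"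
    by (rule iffD1[OF AE_distr_iff[OF R' B]])
  then have "AE s in powr_density M \<alpha> (W f0). W F s / W f0 s = F (\<Phi> s) / f0 (\<Phi> s)"
    using F by (simp add: point_def \<Phi> Int_absorb1[OF D0])
  then have "AE s in M. 0 < ennreal (W f0 s powr \<alpha>) \<longrightarrow> W F s / W f0 s = F (\<Phi> s) / f0 (\<Phi> s)"
    unfolding AE_density[OF fm(2)] .
  then show ?thesis
    using max_isometry_vanishes[OF \<alpha> iso D cone F f0D full] AE_space
  proof eventually_elim
    case (elim s)
    show ?case
    proof (cases "W f0 s = 0")
      case True
      then show ?thesis using elim by simp
    next
      case False
      then have "W F s / W f0 s = F (\<Phi> s) / f0 (\<Phi> s)" using elim by simp
      then show ?thesis using False by (simp add: field_simps)
    qed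
  qed
qed

text \<open>By equality of laws the image of \<open>(W f0) ^ \<alpha> dM\<close> under \<open>\<Phi>\<close> is \<open>f0 ^ \<alpha> dL\<close>; dividing both densities by
  \<open>f0 ^ \<alpha>\<close> gives the claim.\<close>

lemma max_isometry_pushforward:
  assumes \<alpha>: "0 < \<alpha>" and iso: "max_linear_isometry L D M (Lplus M \<alpha>) \<alpha> W"
    and D: "D \<subseteq> Lplus L \<alpha>" and cone: "max_cone D" and f0: "f0 \<in> D"
    and full: "AE x in L. 0 < f0 x"
    and \<psi>: "\<psi> \<in> measurable (Pi\<^sub>M D (\<lambda>_. borel)) L"
    and rec: "AE x in L. 0 < f0 x \<longrightarrow> \<psi> (\<lambda>F\<in>D. F x / f0 x) = x"
    and \<Phi>: "\<And>s. \<Phi> s = \<psi> (\<lambda>F\<in>D. W F s / W f0 s)"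
  shows "distr (powr_density M \<alpha> (\<lambda>s. W f0 s / f0 (\<Phi> s))) L \<Phi> = L"
proof -
  let ?P = "Pi\<^sub>M D (\<lambda>_. borel :: real measure)"
  let ?\<nu> = "powr_density L \<alpha> f0" and ?\<nu>' = "powr_density M \<alpha> (W f0)"
  have WL: "\<And>F. F \<in> D \<Longrightarrow> W F \<in> Lplus M \<alpha>" using max_linear_isometryD(1)[OF iso] .
  have L1: "F \<in> borel_measurable L" if "F \<in> D" for F using that D by (auto intro: LplusD(1))
  have [measurable]: "f0 \<in> borel_measurable L" "W f0 \<in> borel_measurable M"
    using L1[OF f0] LplusD(1)[OF WL[OF f0]] by auto
  have R: "(\<lambda>x. \<lambda>F\<in>D. F x / f0 x) \<in> measurable ?\<nu> ?P"
    using measurable_ratios[OF L1 L1[OF f0]] by simp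
  have R': "(\<lambda>s. \<lambda>F\<in>D. W F s / W f0 s) \<in> measurable ?\<nu>' ?P"
    using measurable_ratios[of D W, OF LplusD(1)[OF WL] LplusD(1)[OF WL[OF f0]]] by simp
  have \<Phi>_eq: "\<Phi> = (\<lambda>s. \<psi> (\<lambda>F\<in>D. W F s / W f0 s))" using \<Phi> by auto
  have \<Phi>_meas [measurable]: "\<Phi> \<in> measurable M L"
    unfolding \<Phi>_eq by (rule measurable_reconstruction[OF iso f0 \<psi>])
  have "distr ?\<nu>' L \<Phi> = distr (distr ?\<nu>' ?P (\<lambda>s. \<lambda>F\<in>D. W F s / W f0 s)) L \<psi>"
    by (subst distr_distr[OF \<psi> R']) (simp add: \<Phi>_eq comp_def)
  also have "\<dots> = distr (distr ?\<nu> ?P (\<lambda>x. \<lambda>F\<in>D. F x / f0 x)) L \<psi>"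
    unfolding max_isometry_ratio_law[OF \<alpha> iso D cone f0] ..
  also have "\<dots> = distr ?\<nu> L (\<psi> \<circ> (\<lambda>x. \<lambda>F\<in>D. F x / f0 x))"
    by (rule distr_distr[OF \<psi> R])
  also have "\<dots> = distr ?\<nu> L (\<lambda>x. x)"
  proof (rule distr_cong_AE)
    show "AE x in ?\<nu>. (\<psi> \<circ> (\<lambda>x. \<lambda>F\<in>D. F x / f0 x)) x = x"
      by (subst AE_density) (use rec full in \<open>auto elim!: eventually_rev_mp\<close>)
    show "\<psi> \<circ> (\<lambda>x. \<lambda>F\<in>D. F x / f0 x) \<in> measurable ?\<nu> L" using R \<psi> by (rule measurable_comp)
  qed simp_all
  also have "\<dots> = ?\<nu>" by (rule distr_id2) simp
  finally have law: "distr ?\<nu>' L \<Phi> = ?\<nu>" .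
  show ?thesis
  proof (rule measure_eqI)
    fix B assume "B \<in> sets (distr (powr_density M \<alpha> (\<lambda>s. W f0 s / f0 (\<Phi> s))) L \<Phi>)"
    then have B [measurable]: "B \<in> sets L" by simp
    define k where "k x = ennreal (1 / f0 x powr \<alpha>) * indicator B x" for x
    have k_meas [measurable]: "k \<in> borel_measurable L" unfolding k_def by measurable
    have preB: "\<Phi> -` B \<inter> space M \<in> sets M" using measurable_sets[OF \<Phi>_meas B] .
    have "emeasure (distr (powr_density M \<alpha> (\<lambda>s. W f0 s / f0 (\<Phi> s))) L \<Phi>) B
        = emeasure (powr_density M \<alpha> (\<lambda>s. W f0 s / f0 (\<Phi> s))) (\<Phi> -` B \<inter> space M)"
      by (subst emeasure_distr) simp_all
    also have "\<dots> = (\<integral>\<^sup>+s. ennreal ((W f0 s / f0 (\<Phi> s)) powr \<alpha>) * indicator (\<Phi> -` B \<inter> space M) s \<partial>M)"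
      by (rule emeasure_density[OF _ preB]) measurable
    also have "\<dots> = (\<integral>\<^sup>+s. ennreal (W f0 s powr \<alpha>) * k (\<Phi> s) \<partial>M)"
    proof (rule nn_integral_cong)
      fix s assume s: "s \<in> space M"
      have nn: "0 \<le> W f0 s" "0 \<le> f0 (\<Phi> s)"
        using s LplusD(2)[OF WL[OF f0]] measurable_space[OF \<Phi>_meas s] D f0 LplusD(2)[of f0 L \<alpha>] by auto
      have "ennreal ((W f0 s / f0 (\<Phi> s)) powr \<alpha>)
          = ennreal (W f0 s powr \<alpha>) * ennreal (1 / f0 (\<Phi> s) powr \<alpha>)"
        using nn by (simp add: powr_divide ennreal_mult[symmetric])
      then show "ennreal ((W f0 s / f0 (\<Phi> s)) powr \<alpha>) * indicator (\<Phi> -` B \<inter> space M) s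
          = ennreal (W f0 s powr \<alpha>) * k (\<Phi> s)"
        using s by (simp add: k_def mult.assoc indicator_def)
    qed
    also have "\<dots> = (\<integral>\<^sup>+s. k (\<Phi> s) \<partial>?\<nu>')"
      by (subst nn_integral_density) simp_all
    also have "\<dots> = (\<integral>\<^sup>+x. k x \<partial>distr ?\<nu>' L \<Phi>)"
      by (subst nn_integral_distr) simp_all
    also have "\<dots> = (\<integral>\<^sup>+x. k x \<partial>?\<nu>)" unfolding law ..
    also have "\<dots> = (\<integral>\<^sup>+x. ennreal (f0 x powr \<alpha>) * k x \<partial>L)"
      by (subst nn_integral_density) simp_all
    also have "\<dots> = (\<integral>\<^sup>+x. indicator B x \<partial>L)"
    proof (rule nn_integral_cong_AE)
      show "AE x in L. ennreal (f0 x powr \<alpha>) * k x = indicator B x"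
        using full
      proof eventually_elim
        case (elim x)
        then have "ennreal (f0 x powr \<alpha>) * ennreal (1 / f0 x powr \<alpha>) = 1"
          by (subst ennreal_mult[symmetric]) auto
        then show ?case by (simp add: k_def mult.assoc[symmetric])
      qed
    qed
    also have "\<dots> = emeasure L B" by simp
    finally show "emeasure (distr (powr_density M \<alpha> (\<lambda>s. W f0 s / f0 (\<Phi> s))) L \<Phi>) B = emeasure L B" .
  qed simp
qed

section \<open>Closed max-spans\<close>

lemma max_span_single:
  assumes "t \<in> T" "0 < a"
  shows "(\<lambda>s. a * f t s) \<in> max_span f T"
  unfolding max_span_def
  by (rule CollectI, rule exI[of _ 1], rule exI[of _ "\<lambda>_. a"], rule exI[of _ "\<lambda>_. t"])
    (use assms in auto)

lemma max_span_max:
  assumes "k \<in> max_span f T" "t \<in> T" "0 < a"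
  shows "(\<lambda>s. max (k s) (a * f t s)) \<in> max_span f T"
proof -
  obtain n b u where k: "k = (\<lambda>s. Max ((\<lambda>i. b i * f (u i) s) ` {1..n}))" "1 \<le> n"
    "\<forall>i\<in>{1..n::nat}. 0 < b i \<and> u i \<in> T"
    using assms(1) unfolding max_span_def by blast
  define b' where "b' = b(Suc n := a)"
  define u' where "u' = u(Suc n := t)"
  have "max (k s) (a * f t s) = Max ((\<lambda>i. b' i * f (u' i) s) ` {1..Suc n})" for s
  proof -
    have "(\<lambda>i. b' i * f (u' i) s) ` {1..n} = (\<lambda>i. b i * f (u i) s) ` {1..n}"
      by (rule image_cong) (auto simp: b'_def u'_def)
    then have "(\<lambda>i. b' i * f (u' i) s) ` {1..Suc n}
        = insert (a * f t s) ((\<lambda>i. b i * f (u i) s) ` {1..n})"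
      by (simp add: atLeastAtMostSuc_conv b'_def u'_def)
    then show ?thesis using k by (simp add: max.commute)
  qed
  moreover have "\<forall>i\<in>{1..Suc n}. 0 < b' i \<and> u' i \<in> T"
    using k(3) assms by (auto simp: b'_def u'_def)
  ultimately show ?thesis
    unfolding max_span_def
    by (intro CollectI exI[of _ "Suc n"] exI[of _ b'] exI[of _ u']) auto
qed

lemma max_span_induct [consumes 1, case_names single max]:
  assumes k: "k \<in> max_span f T"
    and single: "\<And>t a. t \<in> T \<Longrightarrow> 0 < a \<Longrightarrow> Q (\<lambda>s. a * f t s)"
    and max: "\<And>k t a. k \<in> max_span f T \<Longrightarrow> Q k \<Longrightarrow> t \<in> T \<Longrightarrow> 0 < a \<Longrightarrow> Q (\<lambda>s. max (k s) (a * f t s))"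
  shows "Q k"
proof -
  obtain n b u where k: "k = (\<lambda>s. Max ((\<lambda>i. b i * f (u i) s) ` {1..n}))" "1 \<le> n"
    "\<forall>i\<in>{1..n::nat}. 0 < b i \<and> u i \<in> T"
    using assms(1) unfolding max_span_def by blast
  have "Q (\<lambda>s. Max ((\<lambda>i. b i * f (u i) s) ` {1..m})) \<and>
      (\<lambda>s. Max ((\<lambda>i. b i * f (u i) s) ` {1..m})) \<in> max_span f T" if "1 \<le> m" "m \<le> n" for m
    using that
  proof (induction m rule: nat_induct_at_least)
    case base
    then show ?case using k single[of "u 1" "b 1"] max_span_single[of "u 1" T "b 1" f] by simp
  next
    case (Suc m)
    have eq: "(\<lambda>s. Max ((\<lambda>i. b i * f (u i) s) ` {1..Suc m}))
        = (\<lambda>s. max (Max ((\<lambda>i. b i * f (u i) s) ` {1..m})) (b (Suc m) * f (u (Suc m)) s))"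
      using Suc.hyps by (simp add: atLeastAtMostSuc_conv max.commute)
    have "u (Suc m) \<in> T" "0 < b (Suc m)" using k(3) Suc.prems by auto
    then show ?case unfolding eq using Suc max max_span_max by auto
  qed
  then show ?thesis using k by auto
qed

lemma max_span_scale:
  assumes "k \<in> max_span f T" "0 < c"
  shows "(\<lambda>s. c * k s) \<in> max_span f T"
  using assms(1)
proof (induction rule: max_span_induct)
  case (single t a)
  then show ?case using max_span_single[of t T "c * a" f] assms(2) by (simp add: mult.assoc)
next
  case (max k t a)
  then show ?case
    using max_span_max[of "\<lambda>s. c * k s" f T t "c * a"] assms(2)
    by (simp add: mult.assoc max_mult_distrib_left)
qed

lemma max_cone_max_span: "max_cone (max_span f T)"
  unfolding max_cone_def
proof (intro ballI allI impI)
  fix k k' and a b :: real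
  assume k: "k \<in> max_span f T" and k': "k' \<in> max_span f T" and ab: "0 < a" "0 < b"
  show "(\<lambda>s. max (a * k s) (b * k' s)) \<in> max_span f T"
    using k'
  proof (induction rule: max_span_induct)
    case (single t c)
    then show ?case
      using max_span_max[OF max_span_scale[OF k ab(1)], of t "b * c"] ab by (simp add: mult.assoc)
  next
    case (max k' t c)
    then show ?case
      using max_span_max[OF max.IH, of t "b * c"] ab
      by (simp add: mult.assoc max_mult_distrib_left max.assoc)
  qed
qed

lemma Lplus_max:
  assumes "0 < \<alpha>" "F \<in> Lplus M \<alpha>" "G \<in> Lplus M \<alpha>" "0 \<le> a" "0 \<le> b"
  shows "(\<lambda>x. max (a * F x) (b * G x)) \<in> Lplus M \<alpha>"
proof -
  note [measurable] = LplusD(1)[OF assms(2)] LplusD(1)[OF assms(3)]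
  have "integrable M (\<lambda>x. max (a powr \<alpha> * F x powr \<alpha>) (b powr \<alpha> * G x powr \<alpha>))"
    using LplusD(3)[OF assms(2)] LplusD(3)[OF assms(3)] by simp
  moreover have "max (a powr \<alpha> * F x powr \<alpha>) (b powr \<alpha> * G x powr \<alpha>) = max (a * F x) (b * G x) powr \<alpha>"
    if "x \<in> space M" for x
    using that assms LplusD(2)[OF assms(2)] LplusD(2)[OF assms(3)] by (simp add: max_powr powr_mult)
  ultimately have "integrable M (\<lambda>x. max (a * F x) (b * G x) powr \<alpha>)"
    by (simp cong: Bochner_Integration.integrable_cong)
  moreover have "(\<lambda>x. max (a * F x) (b * G x)) \<in> borel_measurable M" by measurable
  ultimately show ?thesis
    unfolding Lplus_def using assms LplusD(2)[OF assms(2)] by (auto simp: le_max_iff_disj)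
qed

lemma max_cone_Lplus: "0 < \<alpha> \<Longrightarrow> max_cone (Lplus M \<alpha>)"
  unfolding max_cone_def by (auto intro: Lplus_max)

lemma max_span_Lplus:
  assumes "0 < \<alpha>" "\<And>t. t \<in> T \<Longrightarrow> f t \<in> Lplus M \<alpha>" "k \<in> max_span f T"
  shows "k \<in> Lplus M \<alpha>"
  using assms(3)
proof (induction rule: max_span_induct)
  case (single t a)
  then show ?case
    using Lplus_max[OF assms(1) assms(2)[OF single(1)] assms(2)[OF single(1)], of a a] by simp
next
  case (max k t a)
  then show ?case using Lplus_max[OF assms(1) max.IH assms(2), of t 1 a] by simp
qed

lemma rho_dist_self [simp]: "rho_dist M \<alpha> F F = 0"
  by (simp add: rho_dist_def)

lemma closed_max_span_Lplus: "closed_max_span M \<alpha> f T \<subseteq> Lplus M \<alpha>"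
  unfolding closed_max_span_def by auto

lemma max_span_closed_max_span:
  assumes "0 < \<alpha>" "\<And>t. t \<in> T \<Longrightarrow> f t \<in> Lplus M \<alpha>"
  shows "max_span f T \<subseteq> closed_max_span M \<alpha> f T"
  unfolding closed_max_span_def using max_span_Lplus[OF assms] by (auto intro!: bexI[of _ x for x])

lemma generator_closed_max_span:
  assumes "0 < \<alpha>" "\<And>t. t \<in> T \<Longrightarrow> f t \<in> Lplus M \<alpha>" "t \<in> T"
  shows "f t \<in> closed_max_span M \<alpha> f T"
  using subsetD[OF max_span_closed_max_span[OF assms(1,2)] max_span_single[OF assms(3), of 1 f]]
  by simp

lemma abs_max_diff_le: "\<bar>max a b - max c d\<bar> \<le> \<bar>a - c\<bar> + \<bar>b - (d::real)\<bar>"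
  by (auto simp: max_def abs_if)

lemma integrable_rho:
  assumes "F \<in> Lplus M \<alpha>" "G \<in> Lplus M \<alpha>"
  shows "integrable M (\<lambda>x. \<bar>F x powr \<alpha> - G x powr \<alpha>\<bar>)"
  using LplusD(3)[OF assms(1)] LplusD(3)[OF assms(2)] by simp

lemma max_cone_closed_max_span:
  assumes \<alpha>: "0 < \<alpha>" and f: "\<And>t. t \<in> T \<Longrightarrow> f t \<in> Lplus M \<alpha>"
  shows "max_cone (closed_max_span M \<alpha> f T)"
  unfolding max_cone_def
proof (intro ballI allI impI)
  fix F G and a b :: real
  assume F: "F \<in> closed_max_span M \<alpha> f T" and G: "G \<in> closed_max_span M \<alpha> f T" and ab: "0 < a" "0 < b"
  have L: "F \<in> Lplus M \<alpha>" "G \<in> Lplus M \<alpha>"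
    using subsetD[OF closed_max_span_Lplus F] subsetD[OF closed_max_span_Lplus G] by auto
  let ?H = "\<lambda>x. max (a * F x) (b * G x)"
  have HL: "?H \<in> Lplus M \<alpha>" using Lplus_max[OF \<alpha> L] ab by simp
  have "\<exists>k\<in>max_span f T. rho_dist M \<alpha> ?H k < \<epsilon>" if \<epsilon>: "0 < \<epsilon>" for \<epsilon>
  proof -
    have pos: "0 < a powr \<alpha>" "0 < b powr \<alpha>" using ab by auto
    obtain k where k: "k \<in> max_span f T" "rho_dist M \<alpha> F k < \<epsilon> / 2 / a powr \<alpha>"
      using F \<epsilon> pos unfolding closed_max_span_def by (auto dest!: spec[of _ "\<epsilon> / 2 / a powr \<alpha>"])
    obtain k' where k': "k' \<in> max_span f T" "rho_dist M \<alpha> G k' < \<epsilon> / 2 / b powr \<alpha>"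
      using G \<epsilon> pos unfolding closed_max_span_def by (auto dest!: spec[of _ "\<epsilon> / 2 / b powr \<alpha>"])
    have kL: "k \<in> Lplus M \<alpha>" "k' \<in> Lplus M \<alpha>" using max_span_Lplus[OF \<alpha> f k(1)] max_span_Lplus[OF \<alpha> f k'(1)] by auto
    let ?K = "\<lambda>x. max (a * k x) (b * k' x)"
    have K: "?K \<in> max_span f T" using max_coneD[OF max_cone_max_span k(1) k'(1) ab] .
    have "rho_dist M \<alpha> ?H ?K
        \<le> (\<integral>x. a powr \<alpha> * \<bar>F x powr \<alpha> - k x powr \<alpha>\<bar> + b powr \<alpha> * \<bar>G x powr \<alpha> - k' x powr \<alpha>\<bar> \<partial>M)"
      unfolding rho_dist_def
    proof (rule integral_mono)
      show "integrable M (\<lambda>x. \<bar>?H x powr \<alpha> - ?K x powr \<alpha>\<bar>)"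
        by (rule integrable_rho[OF HL max_span_Lplus[OF \<alpha> f K]])
      show "integrable M (\<lambda>x. a powr \<alpha> * \<bar>F x powr \<alpha> - k x powr \<alpha>\<bar> + b powr \<alpha> * \<bar>G x powr \<alpha> - k' x powr \<alpha>\<bar>)"
        using integrable_rho[OF L(1) kL(1)] integrable_rho[OF L(2) kL(2)] by simp
      fix x assume x: "x \<in> space M"
      have "?H x powr \<alpha> = max (a powr \<alpha> * F x powr \<alpha>) (b powr \<alpha> * G x powr \<alpha>)"
        "?K x powr \<alpha> = max (a powr \<alpha> * k x powr \<alpha>) (b powr \<alpha> * k' x powr \<alpha>)"
        using LplusD(2)[OF L(1) x] LplusD(2)[OF L(2) x] LplusD(2)[OF kL(1) x] LplusD(2)[OF kL(2) x]
          ab \<alpha> by (auto simp: max_powr powr_mult)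
      then show "\<bar>?H x powr \<alpha> - ?K x powr \<alpha>\<bar>
          \<le> a powr \<alpha> * \<bar>F x powr \<alpha> - k x powr \<alpha>\<bar> + b powr \<alpha> * \<bar>G x powr \<alpha> - k' x powr \<alpha>\<bar>"
        using abs_max_diff_le[of "a powr \<alpha> * F x powr \<alpha>" "b powr \<alpha> * G x powr \<alpha>"
            "a powr \<alpha> * k x powr \<alpha>" "b powr \<alpha> * k' x powr \<alpha>"] pos
        by (simp add: right_diff_distrib[symmetric] abs_mult)
    qed
    also have "\<dots> = a powr \<alpha> * rho_dist M \<alpha> F k + b powr \<alpha> * rho_dist M \<alpha> G k'"
      using integrable_rho[OF L(1) kL(1)] integrable_rho[OF L(2) kL(2)] by (simp add: rho_dist_def)
    also have "\<dots> < \<epsilon> / 2 + \<epsilon> / 2"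
      using k(2) k'(2) pos by (intro add_strict_mono) (simp_all add: pos_less_divide_eq mult_ac)
    finally show ?thesis using K by auto
  qed
  then show "?H \<in> closed_max_span M \<alpha> f T" using HL unfolding closed_max_span_def by blast
qed

text \<open>The distance is expressible through maxima, since \<open>\<bar>u - v\<bar> = 2 * max u v - u - v\<close>.\<close>

lemma max_isometry_rho:
  assumes \<alpha>: "0 < \<alpha>" and iso: "max_linear_isometry L D M (Lplus M \<alpha>) \<alpha> V"
    and D: "D \<subseteq> Lplus L \<alpha>" and cone: "max_cone D" and F: "F \<in> D" and G: "G \<in> D"
  shows "rho_dist M \<alpha> (V F) (V G) = rho_dist L \<alpha> F G"
proof -
  have abs: "\<bar>u - v\<bar> = 2 * max u v - u - v" for u v :: real by (auto simp: max_def)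
  have L: "F \<in> Lplus L \<alpha>" "G \<in> Lplus L \<alpha>" using D F G by auto
  have M: "V F \<in> Lplus M \<alpha>" "V G \<in> Lplus M \<alpha>" using max_linear_isometryD(1)[OF iso] F G by auto
  define H where "H = (\<lambda>x. max (1 * F x) (1 * G x))"
  have H: "H \<in> D" unfolding H_def using max_coneD[OF cone F G, of 1 1] by simp
  have VH: "AE s in M. V H s = max (1 * V F s) (1 * V G s)"
    unfolding H_def using max_linear_isometryD(2)[OF iso F G, of 1 1] by simp
  have HL: "H \<in> Lplus L \<alpha>" "V H \<in> Lplus M \<alpha>" using H D max_linear_isometryD(1)[OF iso] by auto
  have "rho_dist M \<alpha> (V F) (V G) = (\<integral>s. 2 * V H s powr \<alpha> - V F s powr \<alpha> - V G s powr \<alpha> \<partial>M)"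
    unfolding rho_dist_def
  proof (rule integral_cong_AE)
    show "AE s in M. \<bar>V F s powr \<alpha> - V G s powr \<alpha>\<bar> = 2 * V H s powr \<alpha> - V F s powr \<alpha> - V G s powr \<alpha>"
      using VH AE_space
      by eventually_elim (use LplusD(2)[OF M(1)] LplusD(2)[OF M(2)] \<alpha> in \<open>simp add: abs max_powr\<close>)
  qed (use LplusD(1)[OF M(1)] LplusD(1)[OF M(2)] LplusD(1)[OF HL(2)] in measurable)
  also have "\<dots> = 2 * (\<integral>s. V H s powr \<alpha> \<partial>M) - (\<integral>s. V F s powr \<alpha> \<partial>M) - (\<integral>s. V G s powr \<alpha> \<partial>M)"
    using LplusD(3)[OF M(1)] LplusD(3)[OF M(2)] LplusD(3)[OF HL(2)] by simp
  also have "\<dots> = 2 * (\<integral>s. H s powr \<alpha> \<partial>L) - (\<integral>s. F s powr \<alpha> \<partial>L) - (\<integral>s. G s powr \<alpha> \<partial>L)"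
    using max_linear_isometryD(3)[OF iso] H F G by simp
  also have "\<dots> = (\<integral>s. 2 * H s powr \<alpha> - F s powr \<alpha> - G s powr \<alpha> \<partial>L)"
    using LplusD(3)[OF L(1)] LplusD(3)[OF L(2)] LplusD(3)[OF HL(1)] by simp
  also have "\<dots> = rho_dist L \<alpha> F G"
    unfolding rho_dist_def
    using LplusD(2)[OF L(1)] LplusD(2)[OF L(2)] \<alpha>
    by (intro Bochner_Integration.integral_cong) (auto simp: abs H_def max_powr)
  finally show ?thesis .
qed

text \<open>The two isometries agree on the max-span by max-linearity, and then on its closure by continuity for
  the metric.\<close>

lemma max_isometry_determined_by_generators:
  assumes \<alpha>: "0 < \<alpha>" and f: "\<And>t. t \<in> T \<Longrightarrow> f t \<in> Lplus L \<alpha>"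
    and V: "max_linear_isometry L (closed_max_span L \<alpha> f T) M (Lplus M \<alpha>) \<alpha> V"
    and W: "max_linear_isometry L (closed_max_span L \<alpha> f T) M (Lplus M \<alpha>) \<alpha> W"
    and gen: "\<And>t. t \<in> T \<Longrightarrow> AE s in M. V (f t) s = W (f t) s"
    and F: "F \<in> closed_max_span L \<alpha> f T"
  shows "AE s in M. V F s = W F s"
proof -
  let ?D = "closed_max_span L \<alpha> f T"
  have D: "?D \<subseteq> Lplus L \<alpha>" and cone: "max_cone ?D"
    by (rule closed_max_span_Lplus) (rule max_cone_closed_max_span[where f = f and T = T, OF \<alpha> f])
  have gen_D: "f t \<in> ?D" if "t \<in> T" for t
    by (rule generator_closed_max_span[OF \<alpha> _ that]) (rule f)
  have span_D: "max_span f T \<subseteq> ?D"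
    by (rule max_span_closed_max_span[OF \<alpha>]) (rule f)
  have span: "AE s in M. V k s = W k s" if "k \<in> max_span f T" for k
    using that
  proof (induction rule: max_span_induct)
    case (single t a)
    have ft: "f t \<in> ?D" by (rule gen_D[OF single(1)])
    show ?case
      using gen[OF single(1)] max_linear_isometryD(2)[OF V ft ft less_imp_le[OF single(2)] less_imp_le[OF single(2)]]
        max_linear_isometryD(2)[OF W ft ft less_imp_le[OF single(2)] less_imp_le[OF single(2)]]
      by eventually_elim simp
  next
    case (max k t a)
    have ft: "f t \<in> ?D" by (rule gen_D[OF max.hyps(2)])
    have k: "k \<in> ?D" by (rule subsetD[OF span_D max.hyps(1)])
    show ?case
      using gen[OF max.hyps(2)] max.IH max_linear_isometryD(2)[OF V k ft zero_le_one less_imp_le[OF max.hyps(3)]]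
        max_linear_isometryD(2)[OF W k ft zero_le_one less_imp_le[OF max.hyps(3)]]
      by eventually_elim simp
  qed
  have M: "V F \<in> Lplus M \<alpha>" "W F \<in> Lplus M \<alpha>"
    using max_linear_isometryD(1)[OF V F] max_linear_isometryD(1)[OF W F] by auto
  have "rho_dist M \<alpha> (V F) (W F) \<le> 0 + \<epsilon>" if \<epsilon>: "0 < \<epsilon>" for \<epsilon>
  proof -
    obtain k where k: "k \<in> max_span f T" "rho_dist L \<alpha> F k < \<epsilon> / 2"
      using F \<epsilon> unfolding closed_max_span_def by (auto dest!: spec[of _ "\<epsilon> / 2"])
    have kD: "k \<in> ?D" by (rule subsetD[OF span_D k(1)])
    have kM: "V k \<in> Lplus M \<alpha>" "W k \<in> Lplus M \<alpha>"
      using max_linear_isometryD(1)[OF V kD] max_linear_isometryD(1)[OF W kD] by auto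
    have "rho_dist M \<alpha> (V F) (W F)
        \<le> (\<integral>s. \<bar>V F s powr \<alpha> - V k s powr \<alpha>\<bar> + \<bar>W F s powr \<alpha> - W k s powr \<alpha>\<bar> \<partial>M)"
      unfolding rho_dist_def
    proof (rule integral_mono_AE)
      show "AE s in M. \<bar>V F s powr \<alpha> - W F s powr \<alpha>\<bar>
          \<le> \<bar>V F s powr \<alpha> - V k s powr \<alpha>\<bar> + \<bar>W F s powr \<alpha> - W k s powr \<alpha>\<bar>"
        using span[OF k(1)] by eventually_elim auto
    qed (use integrable_rho[OF M] integrable_rho[OF M(1) kM(1)] integrable_rho[OF M(2) kM(2)] in auto)
    also have "\<dots> = rho_dist M \<alpha> (V F) (V k) + rho_dist M \<alpha> (W F) (W k)"
      unfolding rho_dist_def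
      using integrable_rho[OF M(1) kM(1)] integrable_rho[OF M(2) kM(2)] by simp
    also have "\<dots> = rho_dist L \<alpha> F k + rho_dist L \<alpha> F k"
      using max_isometry_rho[OF \<alpha> V D cone F kD] max_isometry_rho[OF \<alpha> W D cone F kD] by simp
    finally show ?thesis using k(2) by simp
  qed
  then have "rho_dist M \<alpha> (V F) (W F) \<le> 0" by (rule field_le_epsilon)
  moreover have "0 \<le> rho_dist M \<alpha> (V F) (W F)" unfolding rho_dist_def by (rule integral_nonneg_AE) auto
  ultimately have "(\<integral>s. \<bar>V F s powr \<alpha> - W F s powr \<alpha>\<bar> \<partial>M) = 0" unfolding rho_dist_def by simp
  then have "AE s in M. \<bar>V F s powr \<alpha> - W F s powr \<alpha>\<bar> = 0"
    by (subst (asm) integral_nonneg_eq_0_iff_AE[OF integrable_rho[OF M]]) auto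
  with AE_space show ?thesis
  proof eventually_elim
    case (elim s)
    then show ?case
      using powr_less_iff_less[of "V F s" "W F s" \<alpha>] powr_less_iff_less[of "W F s" "V F s" \<alpha>]
        LplusD(2)[OF M(1)] LplusD(2)[OF M(2)] \<alpha> by (auto intro: linorder_cases)
  qed
qed

text \<open>The integral of \<open>G ^ \<alpha>\<close> over \<open>Z\<close> is at most the distance from \<open>G\<close> to any element of the max-span, as
  these elements vanish on \<open>Z\<close>.\<close>

lemma closed_max_span_vanishes:
  assumes \<alpha>: "0 < \<alpha>" and g: "\<And>t. t \<in> T \<Longrightarrow> g t \<in> Lplus M \<alpha>"
    and Z: "Z \<in> sets M" and gen: "\<And>t. t \<in> T \<Longrightarrow> AE s in M. s \<in> Z \<longrightarrow> g t s = 0"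
    and G: "G \<in> closed_max_span M \<alpha> g T"
  shows "AE s in M. s \<in> Z \<longrightarrow> G s = 0"
proof -
  have span: "AE s in M. s \<in> Z \<longrightarrow> k s = 0" if "k \<in> max_span g T" for k
    using that
  proof (induction rule: max_span_induct)
    case (single t a)
    show ?case using gen[OF single(1)] by eventually_elim auto
  next
    case (max k t a)
    show ?case using max.IH gen[OF max.hyps(2)] by eventually_elim auto
  qed
  have GL: "G \<in> Lplus M \<alpha>" by (rule subsetD[OF closed_max_span_Lplus G])
  have intZ: "integrable M (\<lambda>s. indicator Z s * G s powr \<alpha>)"
    using integrable_real_mult_indicator[OF Z LplusD(3)[OF GL]] by (simp add: mult.commute)
  have "(\<integral>s. indicator Z s * G s powr \<alpha> \<partial>M) \<le> 0 + \<epsilon>" if \<epsilon>: "0 < \<epsilon>" for \<epsilon>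
  proof -
    obtain k where k: "k \<in> max_span g T" "rho_dist M \<alpha> G k < \<epsilon>"
      using G \<epsilon> unfolding closed_max_span_def by auto
    have "(\<integral>s. indicator Z s * G s powr \<alpha> \<partial>M) \<le> rho_dist M \<alpha> G k"
      unfolding rho_dist_def
    proof (rule integral_mono_AE[OF intZ integrable_rho[OF GL max_span_Lplus[OF \<alpha> g k(1)]]])
      show "AE s in M. indicator Z s * G s powr \<alpha> \<le> \<bar>G s powr \<alpha> - k s powr \<alpha>\<bar>"
        using span[OF k(1)] by eventually_elim (auto simp: indicator_def)
    qed
    with k(2) show ?thesis by simp
  qed
  then have "(\<integral>s. indicator Z s * G s powr \<alpha> \<partial>M) \<le> 0" by (rule field_le_epsilon)
  moreover have "0 \<le> (\<integral>s. indicator Z s * G s powr \<alpha> \<partial>M)" by (rule integral_nonneg_AE) auto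
  ultimately have "(\<integral>s. indicator Z s * G s powr \<alpha> \<partial>M) = 0" by simp
  then have "AE s in M. indicator Z s * G s powr \<alpha> = 0"
    by (subst (asm) integral_nonneg_eq_0_iff_AE[OF intZ]) auto
  then show ?thesis by eventually_elim auto
qed

section \<open>Extension and point representation of the relating isometry\<close>

text \<open>Over an empty space the spectral integral is 0, so \<open>X t \<le> 1\<close> would have probability 1, whereas a
  Frechet variable exceeds 1 with positive probability.\<close>

lemma frechet_process_space_nonempty:
  assumes proc: "frechet_process P \<alpha> X T" and rep: "spectral_representation P X M \<alpha> f T"
    and t: "t \<in> T"
  shows "space M \<noteq> {}"
proof
  assume empty: "space M = {}"
  have "\<exists>\<sigma>. frechet_rv P \<alpha> \<sigma> (X t)"
    using proc t unfolding frechet_process_def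
    by (elim conjE allE[of _ "1::nat"] allE[of _ "\<lambda>_. 1::real"] allE[of _ "\<lambda>_. t"]) simp
  then obtain \<sigma> where \<sigma>: "frechet_rv P \<alpha> \<sigma> (X t)" ..
  have "measure P {\<omega> \<in> space P. X t \<omega> \<le> 1} = exp (- (\<sigma> powr \<alpha> * 1 powr (- \<alpha>)))"
    using \<sigma> unfolding frechet_rv_def by simp
  also have "\<dots> < 1" using \<sigma> unfolding frechet_rv_def by simp
  finally have "measure P {\<omega> \<in> space P. X t \<omega> \<le> 1} < 1" .
  moreover have "measure P {\<omega> \<in> space P. \<forall>i\<in>{1..1::nat}. X t \<omega> \<le> 1}
      = exp (- (\<integral>s. (Max ((\<lambda>i. inverse 1 * f t s) ` {1..1::nat})) powr \<alpha> \<partial>M))"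
    using rep t unfolding spectral_representation_def
    by (elim conjE allE[of _ "1::nat"] allE[of _ "\<lambda>_. t"] allE[of _ "\<lambda>_. 1"]) simp
  moreover have "(\<integral>s. (Max ((\<lambda>i. inverse 1 * f t s) ` {1..1::nat})) powr \<alpha> \<partial>M) = 0"
    by (rule integral_eq_zero_AE, rule AE_I2) (simp add: empty)
  ultimately show False by simp
qed

lemma point_map_max_linear_isometry:
  assumes \<alpha>: "0 < \<alpha>" and \<Phi>: "\<Phi> \<in> measurable M L" and h: "h \<in> borel_measurable M"
    and nonneg: "\<And>s. s \<in> space M \<Longrightarrow> 0 \<le> h s"
    and law: "L = distr (density M (\<lambda>s. ennreal (h s powr \<alpha>))) L \<Phi>"
  shows "max_linear_isometry L (Lplus L \<alpha>) M (Lplus M \<alpha>) \<alpha> (\<lambda>F s. h s * F (\<Phi> s))"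
proof -
  let ?\<nu> = "powr_density M \<alpha> h"
  have \<Phi>': "\<Phi> \<in> measurable ?\<nu> L" using \<Phi> by simp
  have hm: "(\<lambda>s. h s powr \<alpha>) \<in> borel_measurable M" using h by measurable
  have pw: "(h s * F (\<Phi> s)) powr \<alpha> = h s powr \<alpha> * F (\<Phi> s) powr \<alpha>"
    if "F \<in> Lplus L \<alpha>" "s \<in> space M" for F s
    using nonneg[OF that(2)] LplusD(2)[OF that(1) measurable_space[OF \<Phi> that(2)]] by (simp add: powr_mult)
  have Fm: "(\<lambda>s. F (\<Phi> s)) \<in> borel_measurable M" if "F \<in> Lplus L \<alpha>" for F
    using \<Phi> LplusD(1)[OF that] by (rule measurable_compose)
  have FmL: "(\<lambda>x. F x powr \<alpha>) \<in> borel_measurable L" if "F \<in> Lplus L \<alpha>" for F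
    using LplusD(1)[OF that] by measurable
  have FmM: "(\<lambda>s. F (\<Phi> s) powr \<alpha>) \<in> borel_measurable M" if "F \<in> Lplus L \<alpha>" for F
    using Fm[OF that] by measurable
  have int: "integrable M (\<lambda>s. h s powr \<alpha> * F (\<Phi> s) powr \<alpha>)" if F: "F \<in> Lplus L \<alpha>" for F
  proof -
    have "integrable (distr ?\<nu> L \<Phi>) (\<lambda>x. F x powr \<alpha>)" using LplusD(3)[OF F] law by simp
    then have "integrable ?\<nu> (\<lambda>s. F (\<Phi> s) powr \<alpha>)"
      by (subst (asm) integrable_distr_eq[OF \<Phi>' FmL[OF F]])
    then show ?thesis by (subst (asm) integrable_density[OF FmM[OF F] hm]) auto
  qed
  have "(\<integral>s. (h s * F (\<Phi> s)) powr \<alpha> \<partial>M) = (\<integral>x. F x powr \<alpha> \<partial>L)" if F: "F \<in> Lplus L \<alpha>" for F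
  proof -
    have "(\<integral>x. F x powr \<alpha> \<partial>L) = (\<integral>x. F x powr \<alpha> \<partial>distr ?\<nu> L \<Phi>)" using law by simp
    also have "\<dots> = (\<integral>s. F (\<Phi> s) powr \<alpha> \<partial>?\<nu>)" by (rule integral_distr[OF \<Phi>' FmL[OF F]])
    also have "\<dots> = (\<integral>s. h s powr \<alpha> * F (\<Phi> s) powr \<alpha> \<partial>M)"
      by (subst integral_density[OF FmM[OF F] hm]) auto
    also have "\<dots> = (\<integral>s. (h s * F (\<Phi> s)) powr \<alpha> \<partial>M)"
      by (rule Bochner_Integration.integral_cong) (simp_all add: pw[OF F])
    finally show ?thesis by simp
  qed
  moreover have "(\<lambda>s. h s * F (\<Phi> s)) \<in> Lplus M \<alpha>" if F: "F \<in> Lplus L \<alpha>" for F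
    unfolding Lplus_def
  proof (intro CollectI conjI ballI)
    show "(\<lambda>s. h s * F (\<Phi> s)) \<in> borel_measurable M" using h Fm[OF F] by (rule borel_measurable_times)
    show "0 \<le> h s * F (\<Phi> s)" if "s \<in> space M" for s
      using nonneg[OF that] LplusD(2)[OF F measurable_space[OF \<Phi> that]] by simp
    show "integrable M (\<lambda>s. (h s * F (\<Phi> s)) powr \<alpha>)"
      using int[OF F] by (simp add: pw[OF F] cong: Bochner_Integration.integrable_cong)
  qed
  moreover have "h s * max (a1 * F1 (\<Phi> s)) (a2 * F2 (\<Phi> s))
      = max (a1 * (h s * F1 (\<Phi> s))) (a2 * (h s * F2 (\<Phi> s)))" if "s \<in> space M" for s a1 a2 F1 F2
    using nonneg[OF that] by (simp add: max_mult_distrib_left mult.left_commute)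
  ultimately show ?thesis
    unfolding max_linear_isometry_def by (auto intro!: AE_I2)
qed

text \<open>This allows an extension of \<open>U\<close> to be replaced by one that coincides with \<open>U\<close> exactly, and not just almost
  everywhere for each function separately: the point map depends on uncountably many functions at once.\<close>

lemma max_linear_isometry_cong_AE:
  assumes iso: "max_linear_isometry L D M (Lplus M \<alpha>) \<alpha> W"
    and eq: "\<And>F. AE s in M. W' F s = W F s" and "\<And>F. F \<in> D \<Longrightarrow> W' F \<in> Lplus M \<alpha>"
  shows "max_linear_isometry L D M (Lplus M \<alpha>) \<alpha> W'"
  unfolding max_linear_isometry_def
proof (intro conjI ballI allI impI)
  fix F assume F: "F \<in> D"
  show "W' F \<in> Lplus M \<alpha>" by (rule assms(3)[OF F])
  have "(\<integral>s. W' F s powr \<alpha> \<partial>M) = (\<integral>s. W F s powr \<alpha> \<partial>M)"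
  proof (rule integral_cong_AE)
    show "AE s in M. W' F s powr \<alpha> = W F s powr \<alpha>" using eq[of F] by eventually_elim simp
  qed (use LplusD(1)[OF assms(3)[OF F]] LplusD(1)[OF max_linear_isometryD(1)[OF iso F]] in measurable)
  then show "(\<integral>s. W' F s powr \<alpha> \<partial>M) = (\<integral>x. F x powr \<alpha> \<partial>L)"
    using max_linear_isometryD(3)[OF iso F] by simp
next
  fix F G and a b :: real assume *: "F \<in> D" "G \<in> D" "0 \<le> a" "0 \<le> b"
  show "AE s in M. W' (\<lambda>x. max (a * F x) (b * G x)) s = max (a * W' F s) (b * W' G s)"
    using max_linear_isometryD(2)[OF iso *] eq[of F] eq[of G] eq[of "\<lambda>x. max (a * F x) (b * G x)"]
    by eventually_elim simp
qed

text \<open>These functions separate the points of the space, so they recover a point map from the isometry that it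
  induces. Their integrals are finite because the space is bounded below.\<close>

lemma indicator_atMost_Lplus:
  "0 < \<alpha> \<Longrightarrow> (\<lambda>x. indicator {..q} x) \<in> Lplus (lambda_IN I N) \<alpha>"
proof -
  assume \<alpha>: "0 < \<alpha>"
  let ?L = "lambda_IN I N"
  have A: "S_IN I N \<inter> {..q} \<in> sets ?L" using S_IN_borel[of I N] by (simp add: sets_lambda_IN_iff)
  have "finite {n::nat. real n \<le> q}"
    by (rule finite_subset[of _ "{..nat \<lfloor>q\<rfloor>}"]) (auto simp: le_nat_floor)
  moreover have "S_IN I N \<inter> {..q} \<inter> range real \<subseteq> real ` {n. real n \<le> q}" by auto
  ultimately have "finite (S_IN I N \<inter> {..q} \<inter> range real)" by (meson finite_imageI finite_subset)
  moreover have "emeasure lborel (S_IN I N \<inter> {..q} \<inter> {0<..<1}) \<le> emeasure lborel {0<..<1::real}"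
    by (rule emeasure_mono) auto
  ultimately have fin: "emeasure ?L (S_IN I N \<inter> {..q}) < \<infinity>"
    unfolding emeasure_lambda_IN[OF A] by (auto simp: top_unique less_top[symmetric])
  have meas: "(\<lambda>x. indicator {..q} x :: real) \<in> borel_measurable ?L"
    by (subst measurable_cong_sets[OF sets_lambda_IN refl]) (intro measurable_restrict_space1, measurable)
  have "integrable ?L (indicator (S_IN I N \<inter> {..q}) :: real \<Rightarrow> real)"
    using A fin by simp
  then have "integrable ?L (\<lambda>x. (indicator {..q} x :: real) powr \<alpha>)"
    by (rule Bochner_Integration.integrable_cong[THEN iffD1, rotated 2])
      (use \<alpha> in \<open>auto simp: indicator_def\<close>)
  then show ?thesis unfolding Lplus_def using meas by auto
qed

lemma emeasure_eq_0_AE_set: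
  assumes "AE s in M. s \<notin> A"
  shows "emeasure M A = 0"
proof (cases "A \<in> sets M")
  case True
  then have "A \<in> null_sets M" using AE_iff_null_sets[OF True] assms by blast
  then show ?thesis by (rule null_setsD1)
qed (rule emeasure_notin_sets)

theorem theorem4p2:
  fixes \<alpha> :: real and I :: nat and N :: enat
    and P :: "'p measure" and X :: "'t \<Rightarrow> 'p \<Rightarrow> real" and T :: "'t set"
    and M :: "'b measure"
    and f :: "'t \<Rightarrow> real \<Rightarrow> real" and g :: "'t \<Rightarrow> 'b \<Rightarrow> real"
    and U :: "(real \<Rightarrow> real) \<Rightarrow> ('b \<Rightarrow> real)"
  assumes "0 < \<alpha>" and "I \<in> {0, 1}"
    and "prob_space P" and "frechet_process P \<alpha> X T"
    and "standard_lebesgue_space M"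
    and "spectral_representation P X (lambda_IN I N) \<alpha> f T"
    and "spectral_representation P X M \<alpha> g T"
    and "max_linear_isometry (lambda_IN I N) (closed_max_span (lambda_IN I N) \<alpha> f T)
           M (closed_max_span M \<alpha> g T) \<alpha> U"
    and "\<forall>t\<in>T. AE s in M. U (f t) s = g t s"
    and "minimal_family (lambda_IN I N) \<alpha> f T"
  shows
    "(\<exists>V. max_linear_isometry (lambda_IN I N) (Lplus (lambda_IN I N) \<alpha>) M (Lplus M \<alpha>) \<alpha> V \<and>
          (\<forall>F\<in>closed_max_span (lambda_IN I N) \<alpha> f T. AE s in M. V F s = U F s) \<and>
          (\<forall>W. max_linear_isometry (lambda_IN I N) (Lplus (lambda_IN I N) \<alpha>) M (Lplus M \<alpha>) \<alpha> W \<and>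
               (\<forall>F\<in>closed_max_span (lambda_IN I N) \<alpha> f T. AE s in M. W F s = U F s) \<longrightarrow>
               (\<forall>F\<in>Lplus (lambda_IN I N) \<alpha>. AE s in M. W F s = V F s)))
     \<and>
     (\<exists>\<Phi> h. represented_by (lambda_IN I N) M \<alpha> f g T U \<Phi> h \<and>
          is_supp M \<alpha> g T {s\<in>space M. 0 < h s} \<and>
          (is_supp M \<alpha> g T (space M) \<longrightarrow> (\<forall>s\<in>space M. 0 < h s)) \<and>
          (\<forall>\<Phi>' h'. represented_by (lambda_IN I N) M \<alpha> f g T U \<Phi>' h' \<longrightarrow>
               (AE s in M. 0 < h s \<longrightarrow> \<Phi>' s = \<Phi> s)))"
proof -
  let ?L = "lambda_IN I N"
  note \<alpha> = assms(1)
  have f: "f t \<in> Lplus ?L \<alpha>" if "t \<in> T" for t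
    using assms(6) that unfolding spectral_representation_def by auto
  have g: "g t \<in> Lplus M \<alpha>" if "t \<in> T" for t
    using assms(7) that unfolding spectral_representation_def by auto
  have gen: "AE s in M. U (f t) s = g t s" if "t \<in> T" for t using assms(9) that by auto
  define D where "D = closed_max_span ?L \<alpha> f T"
  define C where "C = closed_max_span M \<alpha> g T"
  have D: "D \<subseteq> Lplus ?L \<alpha>" and C: "C \<subseteq> Lplus M \<alpha>"
    unfolding D_def C_def by (rule closed_max_span_Lplus)+
  have cone: "max_cone D" unfolding D_def by (rule max_cone_closed_max_span[OF \<alpha>]) (rule f)
  have fD: "f t \<in> D" if "t \<in> T" for t
    unfolding D_def by (rule generator_closed_max_span[OF \<alpha> _ that]) (rule f)
  have UC: "U F \<in> C" if "F \<in> D" for F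
    using max_linear_isometryD(1)[OF assms(8)] that unfolding C_def D_def .
  have U: "max_linear_isometry ?L D M (Lplus M \<alpha>) \<alpha> U"
    using assms(8) C unfolding max_linear_isometry_def C_def[symmetric] D_def[symmetric] by blast

  obtain f0 where f0: "f0 \<in> D"
    and full_em: "emeasure ?L ((space ?L - {s \<in> space ?L. f0 s \<noteq> 0})
      \<union> ({s \<in> space ?L. f0 s \<noteq> 0} - space ?L)) = 0"
    using assms(10) unfolding minimal_family_def is_supp_def D_def by blast
  have f0L: "f0 \<in> Lplus ?L \<alpha>" using f0 D by auto
  have full: "AE x in ?L. 0 < f0 x"
  proof -
    have [measurable]: "f0 \<in> borel_measurable ?L" by (rule LplusD(1)[OF f0L])
    have "(space ?L - {s \<in> space ?L. f0 s \<noteq> 0}) \<union> ({s \<in> space ?L. f0 s \<noteq> 0} - space ?L)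
        = {s \<in> space ?L. f0 s = 0}" by auto
    moreover have "{s \<in> space ?L. f0 s = 0} \<in> sets ?L" by measurable
    ultimately have "{s \<in> space ?L. f0 s = 0} \<in> null_sets ?L" using full_em by (simp add: null_sets_def)
    then have "AE x in ?L. x \<notin> {s \<in> space ?L. f0 s = 0}" by (rule AE_not_in)
    with AE_space show ?thesis
    proof eventually_elim
      case (elim x)
      then show ?case using LplusD(2)[OF f0L, of x] by auto
    qed
  qed
  have "\<exists>t. t \<in> T"
  proof -
    obtain k where "k \<in> max_span f T"
      using f0 zero_less_one unfolding D_def closed_max_span_def by blast
    then show ?thesis unfolding max_span_def by fastforce
  qed
  then obtain t0 where "t0 \<in> T" ..
  then have ne: "S_IN I N \<noteq> {}"
    using frechet_process_space_nonempty[OF assms(4,6)] by simp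

  obtain \<psi> where \<psi>: "\<psi> \<in> measurable (Pi\<^sub>M D (\<lambda>_. borel :: real measure)) ?L"
    and rec: "AE x in ?L. 0 < f0 x \<longrightarrow> \<psi> (\<lambda>F\<in>D. F x / f0 x) = x"
  proof (rule minimal_family_reconstruction[of I N f T D f0])
    show "\<exists>A\<in>ratio_sigma ?L f T. emeasure ?L ((A - B) \<union> (B - A)) = 0" if "B \<in> sets ?L" for B
      using assms(10) that unfolding minimal_family_def by blast
    show "f t \<in> borel_measurable ?L" if "t \<in> T" for t by (rule LplusD(1)[OF f[OF that]])
    show "0 \<le> f t x" if "t \<in> T" "x \<in> S_IN I N" for t x using LplusD(2)[OF f] that by simp
  qed (use fD ne in auto)

  define \<Phi>0 where "\<Phi>0 s = \<psi> (\<lambda>F\<in>D. U F s / U f0 s)" for s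
  define h0 where "h0 s = U f0 s / f0 (\<Phi>0 s)" for s
  have Uf0: "U f0 \<in> Lplus M \<alpha>" using UC[OF f0] C by auto
  have \<Phi>0: "\<Phi>0 \<in> measurable M ?L"
    using measurable_reconstruction[OF U f0 \<psi>] unfolding \<Phi>0_def .
  have h0: "h0 \<in> borel_measurable M"
    unfolding h0_def using LplusD(1)[OF Uf0] measurable_compose[OF \<Phi>0 LplusD(1)[OF f0L]]
    by (rule borel_measurable_divide)
  have h0_nonneg: "0 \<le> h0 s" if "s \<in> space M" for s
    unfolding h0_def
    using LplusD(2)[OF Uf0 that] LplusD(2)[OF f0L measurable_space[OF \<Phi>0 that]] by simp
  have law0: "distr (powr_density M \<alpha> h0) ?L \<Phi>0 = ?L"
    unfolding h0_def by (rule max_isometry_pushforward[OF \<alpha> U D cone f0 full \<psi> rec \<Phi>0_def])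
  have U_form: "AE s in M. U F s = h0 s * F (\<Phi>0 s)" if "F \<in> D" for F
    unfolding h0_def
    by (rule max_isometry_point_form[OF \<alpha> U D cone order_refl f0 full \<psi> rec \<Phi>0_def that])

  obtain \<Phi> where \<Phi>: "\<Phi> \<in> measurable M ?L" and \<Phi>_AE: "AE s in M. \<Phi> s = \<Phi>0 s"
    and onto: "\<Phi> ` space M = S_IN I N"
  proof (rule surjective_modification[of M \<Phi>0 I N "\<lambda>s. ennreal (h0 s powr \<alpha>)"])
    show "standard_borel_space M" using assms(5) unfolding standard_lebesgue_space_def by simp
    show "(\<lambda>s. ennreal (h0 s powr \<alpha>)) \<in> borel_measurable M" using h0 by measurable
  qed (use \<Phi>0 law0 in auto)
  \<comment> \<open>If \<open>h0\<close> is almost everywhere positive, it is made positive everywhere, as required when the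
    family \<open>g\<close> has full support.\<close>
  define h where "h = (if AE s in M. 0 < h0 s then (\<lambda>s. if 0 < h0 s then h0 s else 1) else h0)"
  have h: "h \<in> borel_measurable M" unfolding h_def using h0 by auto
  have h_nonneg: "0 \<le> h s" if "s \<in> space M" for s unfolding h_def using h0_nonneg[OF that] by auto
  have h_AE: "AE s in M. h s = h0 s"
  proof (cases "AE s in M. 0 < h0 s")
    case True
    then show ?thesis by eventually_elim (simp add: h_def True)
  qed (simp add: h_def)
  have law: "?L = distr (powr_density M \<alpha> h) ?L \<Phi>"
  proof -
    have "powr_density M \<alpha> h = powr_density M \<alpha> h0"
      by (rule density_cong) (use h h0 h_AE in \<open>auto elim: eventually_mono\<close>)
    moreover have "AE s in powr_density M \<alpha> h. \<Phi> s = \<Phi>0 s"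
      using h \<Phi>_AE by (subst AE_density) (auto elim: eventually_mono)
    ultimately have "distr (powr_density M \<alpha> h) ?L \<Phi> = distr (powr_density M \<alpha> h0) ?L \<Phi>0"
      using \<Phi> \<Phi>0 by (intro distr_cong_AE) simp_all
    also have "\<dots> = ?L" by (rule law0)
    finally show ?thesis by (rule sym)
  qed
  define V where "V F s = h s * F (\<Phi> s)" for F :: "real \<Rightarrow> real" and s
  have V0: "AE s in M. V F s = h0 s * F (\<Phi>0 s)" for F
    using h_AE \<Phi>_AE by eventually_elim (simp add: V_def)
  have VU: "AE s in M. V F s = U F s" if "F \<in> D" for F
    using V0[of F] U_form[OF that] by eventually_elim simp
  have V: "max_linear_isometry ?L (Lplus ?L \<alpha>) M (Lplus M \<alpha>) \<alpha> V"
    using point_map_max_linear_isometry[OF \<alpha> \<Phi> h h_nonneg law] unfolding V_def[abs_def] .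
  have unique: "AE s in M. W F s = V F s"
    if W: "max_linear_isometry ?L (Lplus ?L \<alpha>) M (Lplus M \<alpha>) \<alpha> W"
      and WU: "\<forall>F\<in>D. AE s in M. W F s = U F s" and F: "F \<in> Lplus ?L \<alpha>" for W F
  proof -
    \<comment> \<open>Agreement of \<open>W\<close> and \<open>U\<close> on \<open>D\<close> is made exact, so that both have the same point map.\<close>
    define W' where "W' F = (if F \<in> D then U F else W F)" for F
    have W'W: "AE s in M. W' F s = W F s" for F
    proof (cases "F \<in> D")
      case True
      then have "AE s in M. W F s = U F s" using WU by blast
      then show ?thesis by eventually_elim (simp add: W'_def True)
    qed (simp add: W'_def)
    have W': "max_linear_isometry ?L (Lplus ?L \<alpha>) M (Lplus M \<alpha>) \<alpha> W'"
      using W W'W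
    proof (rule max_linear_isometry_cong_AE)
      show "W' F \<in> Lplus M \<alpha>" if "F \<in> Lplus ?L \<alpha>" for F
        using max_linear_isometryD(1)[OF W that] UC C by (auto simp: W'_def)
    qed
    have "\<Phi>0 s = \<psi> (\<lambda>F\<in>D. W' F s / W' f0 s)" for s
      unfolding \<Phi>0_def using f0 by (simp add: W'_def cong: restrict_cong)
    then have "AE s in M. W' F s = (W' f0 s / f0 (\<Phi>0 s)) * F (\<Phi>0 s)"
      by (rule max_isometry_point_form[OF \<alpha> W' order_refl max_cone_Lplus[OF \<alpha>] D f0 full \<psi> rec _ F])
    then have "AE s in M. W' F s = h0 s * F (\<Phi>0 s)"
      using f0 by (simp add: W'_def h0_def)
    then show ?thesis using V0[of F] W'W[of F] by eventually_elim simp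
  qed
  have part_i: "\<exists>V. max_linear_isometry ?L (Lplus ?L \<alpha>) M (Lplus M \<alpha>) \<alpha> V \<and>
      (\<forall>F\<in>D. AE s in M. V F s = U F s) \<and>
      (\<forall>W. max_linear_isometry ?L (Lplus ?L \<alpha>) M (Lplus M \<alpha>) \<alpha> W \<and>
           (\<forall>F\<in>D. AE s in M. W F s = U F s) \<longrightarrow>
           (\<forall>F\<in>Lplus ?L \<alpha>. AE s in M. W F s = V F s))"
    using V VU unique by blast

  have represented: "represented_by ?L M \<alpha> f g T U \<Phi> h"
    unfolding represented_by_def
  proof (intro conjI ballI)
    show "AE s in M. g t s = U (f t) s \<and> U (f t) s = h s * f t (\<Phi> s)" if "t \<in> T" for t
      using gen[OF that] VU[OF fD[OF that]] by eventually_elim (simp add: V_def)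
    show "\<Phi> ` space M = space ?L" using onto by simp
  qed (rule \<Phi> h h_nonneg law | assumption)+

  define Z where "Z = {s \<in> space M. U f0 s = 0}"
  have Z: "Z \<in> sets M" unfolding Z_def using LplusD(1)[OF Uf0] by measurable
  have vanish: "AE s in M. s \<in> Z \<longrightarrow> G s = 0" if "G \<in> C" for G
  proof (rule closed_max_span_vanishes[OF \<alpha> _ Z _ that[unfolded C_def]])
    show "AE s in M. s \<in> Z \<longrightarrow> g t s = 0" if "t \<in> T" for t
      using gen[OF that] max_isometry_vanishes[OF \<alpha> U D cone fD[OF that] f0 full]
      by eventually_elim (simp add: Z_def)
  qed (rule g)
  have support: "AE s in M. 0 < h s \<longleftrightarrow> U f0 s \<noteq> 0"
    using h_AE U_form[OF f0] AE_space
  proof eventually_elim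
    case (elim s)
    have "U f0 s = 0 \<longrightarrow> h0 s = 0" by (simp add: h0_def)
    moreover have "h0 s = 0 \<longrightarrow> U f0 s = 0" using elim(2) by (metis mult_zero_left)
    ultimately show ?case using elim(1) h0_nonneg[OF elim(3)] by auto
  qed
  have supp: "is_supp M \<alpha> g T {s \<in> space M. 0 < h s}"
    unfolding is_supp_def C_def[symmetric]
  proof (intro conjI bexI[OF _ UC[OF f0]] ballI)
    have [measurable]: "U f0 \<in> borel_measurable M" by (rule LplusD(1)[OF Uf0])
    note h [measurable]
    show "{s \<in> space M. 0 < h s} \<in> sets M" by measurable
    show "emeasure M ({s \<in> space M. G s \<noteq> 0} - {s \<in> space M. U f0 s \<noteq> 0}) = 0" if "G \<in> C" for G
      using vanish[OF that] by (intro emeasure_eq_0_AE_set) (auto simp: Z_def elim: eventually_mono)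
    show "emeasure M (({s \<in> space M. 0 < h s} - {s \<in> space M. U f0 s \<noteq> 0})
        \<union> ({s \<in> space M. U f0 s \<noteq> 0} - {s \<in> space M. 0 < h s})) = 0"
      using support by (intro emeasure_eq_0_AE_set) (auto elim: eventually_mono)
  qed
  have supp_full: "\<forall>s\<in>space M. 0 < h s" if full_g: "is_supp M \<alpha> g T (space M)"
  proof -
    obtain g0 where g0: "g0 \<in> C" and em: "emeasure M ((space M - {s \<in> space M. g0 s \<noteq> 0})
        \<union> ({s \<in> space M. g0 s \<noteq> 0} - space M)) = 0"
      using full_g unfolding is_supp_def C_def by blast
    have [measurable]: "g0 \<in> borel_measurable M" using g0 C by (auto dest: LplusD(1))
    have "(space M - {s \<in> space M. g0 s \<noteq> 0}) \<union> ({s \<in> space M. g0 s \<noteq> 0} - space M)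
        = {s \<in> space M. g0 s = 0}" by auto
    moreover have "{s \<in> space M. g0 s = 0} \<in> sets M" by measurable
    ultimately have "{s \<in> space M. g0 s = 0} \<in> null_sets M" using em by (simp add: null_sets_def)
    then have "AE s in M. s \<notin> {s \<in> space M. g0 s = 0}" by (rule AE_not_in)
    then have "AE s in M. 0 < h0 s"
      using vanish[OF g0] support h_AE AE_space by eventually_elim (auto simp: Z_def)
    then show ?thesis unfolding h_def by simp
  qed

  have unique_\<Phi>: "AE s in M. 0 < h s \<longrightarrow> \<Phi>' s = \<Phi> s"
    if rep: "represented_by ?L M \<alpha> f g T U \<Phi>' h'" for \<Phi>' h'
  proof -
    have \<Phi>': "\<Phi>' \<in> measurable M ?L" and h': "h' \<in> borel_measurable M"
      and h'_nonneg: "\<And>s. s \<in> space M \<Longrightarrow> 0 \<le> h' s"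
      and form': "\<And>t. t \<in> T \<Longrightarrow> AE s in M. U (f t) s = h' s * f t (\<Phi>' s)"
      and law': "?L = distr (powr_density M \<alpha> h') ?L \<Phi>'"
      using rep unfolding represented_by_def by (blast intro: eventually_mono)+
    define V' where "V' F s = h' s * F (\<Phi>' s)" for F :: "real \<Rightarrow> real" and s
    have V': "max_linear_isometry ?L (Lplus ?L \<alpha>) M (Lplus M \<alpha>) \<alpha> V'"
      using point_map_max_linear_isometry[OF \<alpha> \<Phi>' h' h'_nonneg law'] unfolding V'_def[abs_def] .
    have V'U: "AE s in M. V' F s = U F s" if "F \<in> D" for F
    proof (rule max_isometry_determined_by_generators[OF \<alpha>, of T f ?L M V' U])
      show "AE s in M. V' (f t) s = U (f t) s" if "t \<in> T" for t
        using form'[OF that] by eventually_elim (simp add: V'_def)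
    qed (use f max_linear_isometry_subset[OF V' D] U that in \<open>simp_all add: D_def\<close>)
    have "AE s in M. V' (\<lambda>x. indicator {..real_of_rat q} x) s = V (\<lambda>x. indicator {..real_of_rat q} x) s" for q
      using unique[OF V' _ indicator_atMost_Lplus[OF \<alpha>]] V'U by blast
    then have "AE s in M. \<forall>q. V' (\<lambda>x. indicator {..real_of_rat q} x) s = V (\<lambda>x. indicator {..real_of_rat q} x) s"
      unfolding AE_all_countable by blast
    then show ?thesis
    proof (eventually_elim, intro impI)
      fix s assume eq: "\<forall>q. V' (\<lambda>x. indicator {..real_of_rat q} x) s = V (\<lambda>x. indicator {..real_of_rat q} x) s"
        and pos: "0 < h s"
      then have ind: "h' s * indicator {..real_of_rat q} (\<Phi>' s) = h s * indicator {..real_of_rat q} (\<Phi> s)" for q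
        unfolding V_def V'_def by simp
      \<comment> \<open>A half-line containing \<open>\<Phi> s\<close> shows that \<open>h' s\<close> is nonzero as well, so the factors can be cancelled.\<close>
      obtain q where "\<Phi> s < real_of_rat q" using of_rat_dense[of "\<Phi> s" "\<Phi> s + 1"] by auto
      then have "h' s \<noteq> 0" using ind[of q] pos by auto
      then have iff: "\<Phi>' s \<le> real_of_rat q \<longleftrightarrow> \<Phi> s \<le> real_of_rat q" for q
        using ind[of q] pos by (cases "\<Phi>' s \<le> real_of_rat q"; cases "\<Phi> s \<le> real_of_rat q") auto
      show "\<Phi>' s = \<Phi> s"
      proof (rule ccontr)
        assume "\<Phi>' s \<noteq> \<Phi> s"
        then consider "\<Phi>' s < \<Phi> s" | "\<Phi> s < \<Phi>' s" by linarith
        then show False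
        proof cases
          case 1
          then obtain q where "\<Phi>' s < real_of_rat q" "real_of_rat q < \<Phi> s" using of_rat_dense by blast
          then show False using iff[of q] by simp
        next
          case 2
          then obtain q where "\<Phi> s < real_of_rat q" "real_of_rat q < \<Phi>' s" using of_rat_dense by blast
          then show False using iff[of q] by simp
        qed
      qed
    qed
  qed
  show ?thesis
  proof (rule conjI[OF part_i[unfolded D_def]], rule exI[of _ \<Phi>], rule exI[of _ h],
      intro conjI impI allI)
    show "represented_by ?L M \<alpha> f g T U \<Phi> h" by (rule represented)
    show "is_supp M \<alpha> g T {s \<in> space M. 0 < h s}" by (rule supp)
    show "\<forall>s\<in>space M. 0 < h s" if "is_supp M \<alpha> g T (space M)" by (rule supp_full[OF that])
    show "AE s in M. 0 < h s \<longrightarrow> \<Phi>' s = \<Phi> s" if "represented_by ?L M \<alpha> f g T U \<Phi>' h'" for \<Phi>' h'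
      by (rule unique_\<Phi>[OF that])
  qed
qed

end
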